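(* Let $R,S\subseteq\mathbb{N}^\mathbb{N}$ both be endowed with $\sigma$-finite Borel measures and let $I,J$ be intervals such that $\infty$ is not an open endpoint of $I$. Then $\mathsf{P}_I\mathsf{C}_R*\mathsf{P}_J\mathsf{C}_S\le_W\mathsf{P}_{I\cdot J}\mathsf{C}_{R\times S}$, where $R\times S$ carries the product measure and $I\cdot J=\{xy:x\in I,y\in J\}$ (with the conventions $0\cdot\infty=0$ and $x\cdot\infty=\infty$ for $x>0$).
   Context: A represented space is a pair $(X,\delta_X)$ where $\delta_X:\subseteq\mathbb{N}^\mathbb{N}\to X$ is a partial surjection; subsets of $\mathbb{N}^\mathbb{N}$ are represented by the identity and pairs by the standard pairing $\langle p,q\rangle(2k)=p(k)$, $\langle p,q\rangle(2k+1)=q(k)$. Problems are partial multi-valued functions. A realizer of $f:\subseteq X\rightrightarrows Y$ is a partial $F:\subseteq\mathbb{N}^\mathbb{N}\to\mathbb{N}^\mathbb{N}$ with $\delta_Y F(p)\in f(\delta_X(p))$ for all $p\in\mathrm{dom}(f\circ\delta_X)$. $f\le_W g$ if there are computable partial $H,K$ such that $p\mapsto H\langle p,GK(p)\rangle$ realizes $f$ for every realizer $G$ of $g$. The compositional product $f*g$ is the Weihrauch degree which is the maximum with respect to $\le_W$ of all compositions $f_0\circ g_0$ with $f_0\le_W f$ and $g_0\le_W g$ (this maximum exists); $f*g\le_W h$ means every such composition is $\le_W h$. Sierpiński space $\mathbb{S}=\{0,1\}$ is represented by $\delta_{\mathbb S}(p)=0$ iff $p$ is constantly zero. $\mathcal{A}_-(X)$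 denotes the closed subsets of $X$ represented by negative information (a name of $A$ is a name of the characteristic function $X\to\mathbb S$ of $X\setminus A$). An interval is an interval of reals with open or closed endpoints, where $\infty$ is allowed as right endpoint, but $[\infty,\infty]$ is not an interval. If $X$ carries a Borel measure $\mu$, probabilistic choice $\mathsf{P}_I\mathsf{C}_X:\subseteq\mathcal{A}_-(X)\rightrightarrows X$, $A\mapsto A$, is defined on all nonempty closed $A$ with $\mu(A)\in I$. *)

theory Defs
  imports "HOL-Analysis.Analysis" "HOL-Library.Nat_Bijection"
begin

type_synonym baire = "nat \<Rightarrow> nat"

(* a representation of a space: a partial map from Baire space; the represented
   space is its range *)
type_synonym 'a rep = "baire \<Rightarrow> 'a option"

definition pair_b :: "baire \<Rightarrow> baire \<Rightarrow> baire" where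
  "pair_b p q = (\<lambda>n. if even n then p (n div 2) else q (n div 2))"

definition lft :: "baire \<Rightarrow> baire" where "lft r = (\<lambda>k. r (2 * k))"
definition rgt :: "baire \<Rightarrow> baire" where "rgt r = (\<lambda>k. r (2 * k + 1))"

definition id_rep :: "baire set \<Rightarrow> baire rep" where
  "id_rep R p = (if p \<in> R then Some p else None)"

definition prod_rep :: "'a rep \<Rightarrow> 'b rep \<Rightarrow> ('a \<times> 'b) rep" where
  "prod_rep d1 d2 r = (case (d1 (lft r), d2 (rgt r)) of
      (Some x, Some y) \<Rightarrow> Some (x, y) | _ \<Rightarrow> None)"

definition sier_rep :: "nat rep" where
  "sier_rep p = Some (if p = (\<lambda>_. 0) then 0 else 1)"

datatype recf = Zf | Sf | Idf nat | Cnf recf "recf list" | Prf recf recf | Mnf recf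

inductive reval :: "recf \<Rightarrow> nat list \<Rightarrow> nat \<Rightarrow> bool" where
  reval_Z: "reval Zf xs 0"
| reval_S: "reval Sf (x # xs) (Suc x)"
| reval_Id: "k < length xs \<Longrightarrow> reval (Idf k) xs (xs ! k)"
| reval_Cn: "list_all2 (\<lambda>g y. reval g xs y) gs ys \<Longrightarrow> reval f ys y \<Longrightarrow> reval (Cnf f gs) xs y"
| reval_Pr0: "reval f xs y \<Longrightarrow> reval (Prf f g) (0 # xs) y"
| reval_PrS: "reval (Prf f g) (n # xs) z \<Longrightarrow> reval g (z # n # xs) y \<Longrightarrow> reval (Prf f g) (Suc n # xs) y"
| reval_Mn: "reval f (n # xs) 0 \<Longrightarrow> (\<forall>m<n. \<exists>v. reval f (m # xs) v \<and> v \<noteq> 0) \<Longrightarrow> reval (Mnf f) xs n"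

definition prefix_code :: "baire \<Rightarrow> nat \<Rightarrow> nat" where
  "prefix_code p k = list_encode (map p [0..<k])"

(* F is computable if some machine (a partial recursive function of the output
   position n and a finite prefix of the input) computes F p on dom F:
   for every n it eventually answers from a long enough prefix, and all its answers are correct *)
definition computable_b :: "(baire \<Rightarrow> baire option) \<Rightarrow> bool" where
  "computable_b F \<longleftrightarrow> (\<exists>c. \<forall>p q. F p = Some q \<longrightarrow> (\<forall>n.
      (\<exists>k v. reval c [n, prefix_code p k] v) \<and>
      (\<forall>k v. reval c [n, prefix_code p k] v \<longrightarrow> v = q n)))"

(* a problem f :\<subseteq> X \<rightrightarrows> Y; dom f = {x. f x \<noteq> {}} *)
definition problem :: "'a rep \<Rightarrow> 'b rep \<Rightarrow> ('a \<Rightarrow> 'b set) \<Rightarrow> bool" where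
  "problem dX dY f \<longleftrightarrow> (\<forall>x. f x \<noteq> {} \<longrightarrow> x \<in> ran dX \<and> f x \<subseteq> ran dY)"

definition realizer :: "'a rep \<Rightarrow> 'b rep \<Rightarrow> ('a \<Rightarrow> 'b set) \<Rightarrow> (baire \<Rightarrow> baire option) \<Rightarrow> bool" where
  "realizer dX dY f F \<longleftrightarrow> (\<forall>p x. dX p = Some x \<longrightarrow> f x \<noteq> {} \<longrightarrow>
      (\<exists>q y. F p = Some q \<and> dY q = Some y \<and> y \<in> f x))"

definition W_le :: "'a rep \<Rightarrow> 'b rep \<Rightarrow> ('a \<Rightarrow> 'b set) \<Rightarrow>
                    'c rep \<Rightarrow> 'd rep \<Rightarrow> ('c \<Rightarrow> 'd set) \<Rightarrow> bool" where
  "W_le dX dY f dU dV g \<longleftrightarrow> (\<exists>H K. computable_b H \<and> computable_b K \<and>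
     (\<forall>G. realizer dU dV g G \<longrightarrow>
        realizer dX dY f (\<lambda>p. case K p of None \<Rightarrow> None
                                   | Some k \<Rightarrow> (case G k of None \<Rightarrow> None
                                                 | Some r \<Rightarrow> H (pair_b p r)))))"

definition mcomp :: "('b \<Rightarrow> 'c set) \<Rightarrow> ('a \<Rightarrow> 'b set) \<Rightarrow> 'a \<Rightarrow> 'c set" where
  "mcomp f g x = (if g x \<noteq> {} \<and> (\<forall>z\<in>g x. f z \<noteq> {}) then \<Union> (f ` g x) else {})"

(* Kleene associates: the standard representation of continuous partial functions
   on Baire space *)
definition assoc_apply :: "baire \<Rightarrow> baire \<Rightarrow> baire option" where
  "assoc_apply p q = (if \<forall>n. \<exists>k. p (prod_encode (n, prefix_code q k)) \<noteq> 0
     then Some (\<lambda>n. p (prod_encode (n, prefix_code q (LEAST k. p (prod_encode (n, prefix_code q k)) \<noteq> 0))) - 1)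
     else None)"

definition sier_fun_name :: "'a rep \<Rightarrow> baire \<Rightarrow> ('a \<Rightarrow> nat) \<Rightarrow> bool" where
  "sier_fun_name dX p h \<longleftrightarrow> (\<forall>q x. dX q = Some x \<longrightarrow>
      (\<exists>r. assoc_apply p q = Some r \<and> sier_rep r = Some (h x)))"

definition neg_name_cond :: "'a::topological_space rep \<Rightarrow> baire \<Rightarrow> 'a set \<Rightarrow> bool" where
  "neg_name_cond dX p A \<longleftrightarrow> closedin (top_of_set (ran dX)) A \<and>
      sier_fun_name dX p (\<lambda>x. if x \<in> ran dX - A then 1 else 0)"

definition closed_neg :: "'a::topological_space rep \<Rightarrow> 'a set rep" where
  "closed_neg dX p = (if \<exists>A. neg_name_cond dX p A then Some (THE A. neg_name_cond dX p A) else None)"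

definition ext_interval :: "bool \<Rightarrow> real \<Rightarrow> ereal \<Rightarrow> bool \<Rightarrow> ereal set" where
  "ext_interval lc a b rc = {x. (if lc then ereal a \<le> x else ereal a < x) \<and> (if rc then x \<le> b else x < b)}"

definition set_prod_ereal :: "ereal set \<Rightarrow> ereal set \<Rightarrow> ereal set" where
  "set_prod_ereal I J = {x * y | x y. x \<in> I \<and> y \<in> J}"

definition PC :: "ereal set \<Rightarrow> 'a::topological_space measure \<Rightarrow> 'a set \<Rightarrow> 'a set" where
  "PC I M A = (if A \<noteq> {} \<and> closedin (top_of_set (space M)) A \<and> enn2ereal (emeasure M A) \<in> I
               then A else {})"

end

theory Submission
  imports Defs
begin

text \<open>Given a name \<open>p\<close>, the reduction of \<open>g\<^sub>0\<close> names a closed set \<open>A \<subseteq> S\<close> with measure in \<open>J\<close>, and for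
  each \<open>q \<in> A\<close> the reductions compute a name of a closed set \<open>B\<^sub>q \<subseteq> R\<close> with measure in \<open>I\<close>. The product
  problem is asked for a point of \<open>C = {(r, q). q \<in> A \<and> r \<in> B\<^sub>q}\<close>. Negative information about \<open>C\<close> is
  obtained by searching in parallel for a confirmation of \<open>q \<notin> A\<close> and of \<open>r \<notin> B\<^sub>q\<close>; the second search is
  meaningless when \<open>q \<notin> A\<close>, but then the first one succeeds. By Fubini the measure of \<open>C\<close> is the
  integral over \<open>A\<close> of a function with values in \<open>I\<close>, and a mean value argument places it in
  \<open>I \<cdot> J\<close>. For the computability part, machines are replaced by total recursive functions on finite
  prefixes of the input that may answer \<open>None\<close>; this needs a time-bounded simulation of each
  partial recursive function, built by recursion on its program.\<close>

section \<open>Total recursive functions between coded types\<close>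

text \<open>\<open>computable_b\<close> constrains a machine only on the domain of its function:
  elsewhere it may diverge or answer inconsistently on different prefixes. For \<open>q\<close>
  outside \<open>A\<close> the computation of \<open>B q\<close> is of this kind, yet the name of
  \<open>C\<close> must be an associate that answers on all of \<open>R \<times> S\<close>. The
  combined test \<open>E\<close> is therefore made a total function, and currying it gives the name.
  The same name also settles the topology. The sets \<open>B q\<close> vary with \<open>q\<close>
  only through computed names, so closedness of \<open>C\<close> is read off from the name, and
  measurability of the measure of \<open>B q\<close> in \<open>q\<close> follows from that of
  \<open>C\<close>. The hypothesis on the right endpoint of \<open>I\<close> matters where a
  function on a set of finite measure is finite everywhere and still has infinite integral.\<close>

lemma reval_Cn1: "reval g xs y \<Longrightarrow> reval f [y] z \<Longrightarrow> reval (Cnf f [g]) xs z"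
  by (rule reval_Cn[where ys = "[y]"]) auto

lemma reval_Cn2:
  "reval g xs y \<Longrightarrow> reval g' xs y' \<Longrightarrow> reval f [y, y'] z \<Longrightarrow> reval (Cnf f [g, g']) xs z"
  by (rule reval_Cn[where ys = "[y, y']"]) auto

lemma reval_Cn3:
  "reval g xs y \<Longrightarrow> reval g' xs y' \<Longrightarrow> reval g'' xs y'' \<Longrightarrow> reval f [y, y', y''] z
   \<Longrightarrow> reval (Cnf f [g, g', g'']) xs z"
  by (rule reval_Cn[where ys = "[y, y', y'']"]) auto

lemma reval_proj: "k < length xs \<Longrightarrow> v = xs ! k \<Longrightarrow> reval (Idf k) xs v"
  by (auto intro: reval_Id)

lemma reval_Pr:
  assumes "reval f xs (F 0)" "\<And>n. reval g (F n # n # xs) (F (Suc n))"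
  shows "reval (Prf f g) (n # xs) (F n)"
proof (induction n)
  case 0
  show ?case by (rule reval_Pr0) (rule assms)
next
  case (Suc n)
  show ?case by (rule reval_PrS[OF Suc.IH]) (rule assms)
qed

section \<open>Machines for arithmetic and for the Cantor pairing\<close>

definition m_add :: recf where "m_add = Prf (Idf 0) (Cnf Sf [Idf 0])"
definition m_pred :: recf where "m_pred = Prf Zf (Idf 1)"
text \<open>\<open>Prf\<close> recurses on its first argument, so the subtrahend comes first: on
  \<open>[n, m]\<close> the machine computes \<open>m - n\<close>.\<close>

definition m_sub :: recf where "m_sub = Prf (Idf 0) (Cnf m_pred [Idf 0])"
definition m_tri :: recf where "m_tri = Prf Zf (Cnf m_add [Idf 0, Cnf Sf [Idf 1]])"
definition m_pair :: recf where "m_pair = Cnf m_add [Cnf m_tri [Cnf m_add [Idf 0, Idf 1]], Idf 0]"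
definition m_sgn :: recf where "m_sgn = Prf Zf (Cnf Sf [Zf])"
definition m_diag :: recf where
  "m_diag = Prf Zf (Cnf m_add [Idf 0, Cnf m_sub [Cnf m_sub [Cnf Sf [Idf 1], Cnf m_tri [Cnf Sf [Idf 0]]], Cnf Sf [Zf]]])"
definition m_fst :: recf where "m_fst = Cnf m_sub [Cnf m_tri [m_diag], Idf 0]"
definition m_snd :: recf where "m_snd = Cnf m_sub [m_fst, m_diag]"

lemma reval_add: "reval m_add [m, n] (m + n)"
  unfolding m_add_def
  by (rule reval_Pr[where F = "\<lambda>m. m + n"]) (auto intro!: reval_proj reval_Cn1 reval_S)

lemma reval_pred: "reval m_pred [n] (n - 1)"
  unfolding m_pred_def
  by (rule reval_Pr[where F = "\<lambda>n. n - 1"]) (auto intro!: reval_proj reval_Z)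

lemma reval_sub: "reval m_sub [n, m] (m - n)"
  unfolding m_sub_def
proof (rule reval_Pr[where F = "\<lambda>n. m - n"])
  show "reval (Cnf m_pred [Idf 0]) [m - k, k, m] (m - Suc k)" for k
    using reval_pred[of "m - k"] by (auto intro!: reval_proj reval_Cn1)
qed (auto intro!: reval_proj)

lemma reval_tri: "reval m_tri [n] (triangle n)"
  unfolding m_tri_def
proof (rule reval_Pr[where F = triangle])
  show "reval (Cnf m_add [Idf 0, Cnf Sf [Idf 1]]) [triangle k, k] (triangle (Suc k))" for k
    unfolding triangle_Suc
    by (intro reval_Cn2[OF _ _ reval_add] reval_Cn1[OF _ reval_S] reval_proj) auto
qed (auto intro: reval_Z)

lemma reval_pair: "reval m_pair [m, n] (prod_encode (m, n))"
  unfolding m_pair_def prod_encode_def prod.case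
  by (intro reval_Cn2[OF _ _ reval_add] reval_Cn1[OF _ reval_tri] reval_proj) auto

lemma reval_sgn: "reval m_sgn [n] (if n = 0 then 0 else 1)"
  unfolding m_sgn_def
proof (rule reval_Pr[where F = "\<lambda>n. if n = 0 then 0 else 1"])
  fix k :: nat
  show "reval (Cnf Sf [Zf]) [if k = 0 then 0 else 1, k] (if Suc k = 0 then 0 else 1)"
    using reval_S[of 0 "[]"] by (auto intro!: reval_Cn1 reval_Z)
qed (auto intro: reval_Z)

text \<open>The index of the Cantor diagonal through \<open>n\<close>, that is, the largest
  \<open>k\<close> with \<open>triangle k \<le> n\<close>. In truncated subtraction the increment is
  1 exactly when \<open>Suc n\<close> starts the next diagonal, so the pairing is inverted by
  primitive recursion without a search.\<close>

primrec diagonal :: "nat \<Rightarrow> nat" where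
  "diagonal 0 = 0"
| "diagonal (Suc n) = diagonal n + (1 - (triangle (Suc (diagonal n)) - Suc n))"

lemma reval_diag: "reval m_diag [n] (diagonal n)"
  unfolding m_diag_def
proof (rule reval_Pr[where F = diagonal])
  fix k
  have 1: "reval (Cnf Sf [Zf]) xs 1" for xs
    using reval_S[of 0 "[]"] by (auto intro!: reval_Cn1 reval_Z)
  show "reval (Cnf m_add [Idf 0, Cnf m_sub [Cnf m_sub [Cnf Sf [Idf 1], Cnf m_tri [Cnf Sf [Idf 0]]], Cnf Sf [Zf]]])
     [diagonal k, k] (diagonal (Suc k))"
    unfolding diagonal.simps
    by (intro reval_Cn2[OF _ _ reval_add] reval_Cn2[OF _ _ reval_sub] reval_Cn1[OF _ reval_tri] 1
        reval_Cn1[OF _ reval_S] reval_proj) auto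
qed (auto intro: reval_Z)

lemma diagonal_bounds: "triangle (diagonal n) \<le> n \<and> n < triangle (Suc (diagonal n))"
proof (induction n)
  case (Suc n)
  show ?case
  proof (cases "triangle (Suc (diagonal n)) \<le> Suc n")
    case True
    with Suc have "diagonal (Suc n) = Suc (diagonal n)" by simp
    with True Suc show ?thesis by simp
  next
    case False
    then have "diagonal (Suc n) = diagonal n" by simp
    with False Suc show ?thesis by simp
  qed
qed simp

text \<open>\<open>prod_encode (a, b)\<close> is \<open>triangle (a + b) + a\<close>: the offset
  within the diagonal is \<open>a\<close>, and \<open>b\<close> is what remains of the diagonal
  index.\<close>

lemma prod_decode_diagonal:
  "prod_decode n = (n - triangle (diagonal n), diagonal n - (n - triangle (diagonal n)))"
proof -
  let ?k = "diagonal n" and ?m = "n - triangle (diagonal n)"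
  have b: "triangle ?k \<le> n" "n < triangle ?k + Suc ?k"
    using diagonal_bounds[of n] by auto
  then have m: "?m \<le> ?k" by linarith
  have "prod_decode n = prod_decode (triangle ?k + ?m)" using b by simp
  also have "\<dots> = prod_decode_aux ?k ?m" by (rule prod_decode_triangle_add)
  also have "\<dots> = (?m, ?k - ?m)" using m by (subst prod_decode_aux.simps) simp
  finally show ?thesis .
qed

lemma reval_fst: "reval m_fst [n] (fst (prod_decode n))"
  unfolding m_fst_def prod_decode_diagonal fst_conv
  by (intro reval_Cn2[OF _ _ reval_sub] reval_Cn1[OF _ reval_tri] reval_diag reval_proj) auto

lemma reval_snd: "reval m_snd [n] (snd (prod_decode n))"
proof -
  have "snd (prod_decode n) = diagonal n - fst (prod_decode n)"
    by (simp add: prod_decode_diagonal)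
  then show ?thesis
    unfolding m_snd_def
    by (metis reval_Cn2 reval_diag reval_fst reval_sub)
qed

section \<open>Coded types and closure properties of recursive functions\<close>

class coded = fixes enc :: "'a \<Rightarrow> nat"

instantiation nat :: coded begin
definition enc_nat :: "nat \<Rightarrow> nat" where [simp]: "enc_nat n = n"
instance ..
end

instantiation bool :: coded begin
definition enc_bool :: "bool \<Rightarrow> nat" where "enc_bool b = (if b then 1 else 0)"
instance ..
end

instantiation prod :: (coded, coded) coded begin
definition enc_prod :: "'a \<times> 'b \<Rightarrow> nat" where "enc_prod z = prod_encode (enc (fst z), enc (snd z))"
instance ..
end

text \<open>With 0 for \<open>None\<close> and a successor for \<open>Some\<close>, a list and its
  split into head and tail share one code, and so do a number and its optional predecessor. Case
  distinctions on lists and numbers thereby reduce to those on options.\<close>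

instantiation option :: (coded) coded begin
definition enc_option :: "'a option \<Rightarrow> nat" where
  "enc_option z = (case z of None \<Rightarrow> 0 | Some y \<Rightarrow> Suc (enc y))"
instance ..
end

instantiation list :: (coded) coded begin
definition enc_list :: "'a list \<Rightarrow> nat" where "enc_list xs = list_encode (map enc xs)"
instance ..
end

lemma enc_nat_list: "enc (xs :: nat list) = list_encode xs"
  unfolding enc_list_def by (simp add: map_idI)

lemma enc_Cons: "enc (y # ys) = Suc (prod_encode (enc y, enc ys))"
  by (simp add: enc_list_def)

lemma enc_Pair: "enc (a, b) = prod_encode (enc a, enc b)"
  by (simp add: enc_prod_def)

text \<open>Working with typed functions instead of functions on code numbers lets the rules
  \<open>rec_intros\<close> follow the syntax of a term, so that most machines need never be written
  down.\<close>

definition recursive :: "('a::coded \<Rightarrow> 'b::coded) \<Rightarrow> bool" where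
  "recursive f \<longleftrightarrow> (\<exists>c. \<forall>x. reval c [enc x] (enc (f x)))"

lemma recursiveI: "(\<And>x. reval c [enc x] (enc (f x))) \<Longrightarrow> recursive f"
  unfolding recursive_def by blast

lemma recursiveE:
  assumes "recursive f" obtains c where "\<And>x. reval c [enc x] (enc (f x))"
  using assms unfolding recursive_def by blast

named_theorems rec_intros

lemma recursive_id [rec_intros]: "recursive (\<lambda>x. x)"
  by (rule recursiveI[where c = "Idf 0"]) (auto intro: reval_proj)

lemma recursive_const [rec_intros]: "recursive (\<lambda>x. a)"
proof -
  have "\<exists>c. \<forall>x. reval c [x] n" for n
  proof (induction n)
    case 0
    then show ?case by (auto intro: reval_Z)
  next
    case (Suc n)
    then obtain c where "\<forall>x. reval c [x] n" by blast
    then have "\<forall>x. reval (Cnf Sf [c]) [x] (Suc n)" by (auto intro: reval_Cn1 reval_S)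
    then show ?case by blast
  qed
  then obtain c where "\<forall>x. reval c [x] (enc a)" by blast
  then show ?thesis by (intro recursiveI[where c = c]) simp
qed

lemma recursive_compose: "recursive f \<Longrightarrow> recursive g \<Longrightarrow> recursive (\<lambda>x. f (g x))"
  unfolding recursive_def by (metis reval_Cn1)

text \<open>Functions that are the identity on codes, such as \<^term>\<open>prod_decode\<close> and \<^term>\<open>list_encode\<close>.\<close>
lemma recursive_recode: "(\<And>y. enc (g y) = enc y) \<Longrightarrow> recursive f \<Longrightarrow> recursive (\<lambda>x. g (f x))"
  unfolding recursive_def by simp

lemma recursive_Pair [rec_intros]:
  assumes "recursive f" "recursive g" shows "recursive (\<lambda>x. (f x, g x))"
proof -
  from assms obtain c d where "\<And>x. reval c [enc x] (enc (f x))" "\<And>x. reval d [enc x] (enc (g x))"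
    by (metis recursive_def)
  then show ?thesis
    by (intro recursiveI[where c = "Cnf m_pair [c, d]"])
       (auto simp: enc_Pair intro: reval_Cn2 reval_pair)
qed

lemma recursive_fst [rec_intros]:
  assumes "recursive f" shows "recursive (\<lambda>x. fst (f x))"
proof (rule recursive_compose[OF _ assms])
  show "recursive (fst :: 'b \<times> 'c \<Rightarrow> 'b)"
  proof (rule recursiveI[where c = m_fst])
    fix z :: "'b \<times> 'c"
    show "reval m_fst [enc z] (enc (fst z))" using reval_fst[of "enc z"] by (simp add: enc_prod_def)
  qed
qed

lemma recursive_snd [rec_intros]:
  assumes "recursive f" shows "recursive (\<lambda>x. snd (f x))"
proof (rule recursive_compose[OF _ assms])
  show "recursive (snd :: 'b \<times> 'c \<Rightarrow> 'c)"
  proof (rule recursiveI[where c = m_snd])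
    fix z :: "'b \<times> 'c"
    show "reval m_snd [enc z] (enc (snd z))" using reval_snd[of "enc z"] by (simp add: enc_prod_def)
  qed
qed

lemma recursive_Suc [rec_intros]: "recursive f \<Longrightarrow> recursive (\<lambda>x. Suc (f x))"
  by (rule recursive_compose) (auto intro!: recursiveI[where c = Sf] reval_S)

lemma recursive_pred: "recursive f \<Longrightarrow> recursive (\<lambda>x. f x - 1 :: nat)"
  by (rule recursive_compose[where f = "\<lambda>x :: nat. x - 1"])
     (use reval_pred in \<open>auto intro!: recursiveI[where c = m_pred]\<close>)

lemma recursive_Some [rec_intros]:
  assumes "recursive f" shows "recursive (\<lambda>x. Some (f x))"
proof (rule recursive_compose[OF _ assms])
  show "recursive (Some :: 'b \<Rightarrow> 'b option)"
    by (rule recursiveI[where c = Sf]) (auto simp: enc_option_def intro: reval_S)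
qed

lemma recursive_enc [rec_intros]: "recursive f \<Longrightarrow> recursive (\<lambda>x. enc (f x))"
  by (rule recursive_recode) simp_all

lemma recursive_Cons [rec_intros]:
  assumes "recursive f" "recursive g" shows "recursive (\<lambda>x. f x # g x)"
proof -
  have "recursive (\<lambda>x. Suc (enc (f x, g x)))" by (intro rec_intros assms)
  then show ?thesis by (simp add: recursive_def enc_Cons enc_Pair)
qed

lemma recursive_rec_nat [rec_intros]:
  assumes "recursive f" "recursive (\<lambda>y. g (fst y) (fst (snd y)) (snd (snd y)))" "recursive h"
  shows "recursive (\<lambda>x. rec_nat (f x) (\<lambda>n z. g x n z) (h x))"
proof -
  from assms obtain c d e where c: "\<And>x. reval c [enc x] (enc (f x))"
    and d: "\<And>y. reval d [enc y] (enc (g (fst y) (fst (snd y)) (snd (snd y))))"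
    and e: "\<And>x. reval e [enc x] (enc (h x))"
    unfolding recursive_def by blast
  \<comment> \<open>\<open>Prf\<close> hands its step machine the previous value, the counter and
    the parameter; they are repacked into the code of the triple \<open>(x, n, z)\<close>.\<close>
  let ?d = "Cnf d [Cnf m_pair [Idf 2, Cnf m_pair [Idf 1, Idf 0]]]"
  have "reval (Prf c ?d) (n # [enc x]) (enc (rec_nat (f x) (\<lambda>n z. g x n z) n))" for n x
  proof (rule reval_Pr[where F = "\<lambda>n. enc (rec_nat (f x) (\<lambda>n z. g x n z) n)"])
    fix n
    let ?z = "rec_nat (f x) (\<lambda>n z. g x n z) n"
    have "reval d [prod_encode (enc x, prod_encode (n, enc ?z))] (enc (g x n ?z))"
      using d[of "(x, n, ?z)"] by (simp add: enc_Pair)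
    then show "reval ?d [enc ?z, n, enc x] (enc (rec_nat (f x) (\<lambda>n z. g x n z) (Suc n)))"
      by (auto intro!: reval_Cn1 reval_Cn2 reval_pair reval_proj)
  qed (simp add: c)
  then have "reval (Cnf (Prf c ?d) [e, Idf 0]) [enc x] (enc (rec_nat (f x) (\<lambda>n z. g x n z) (h x)))" for x
    using e[of x] by (auto intro!: reval_Cn2 reval_proj)
  then show ?thesis by (rule recursiveI)
qed

text \<open>The branches are only evaluated lazily: \<^term>\<open>h\<close> need not be meaningful on codes that do not
  come from a value, so the recursion runs over the sign of the code and not over the code.\<close>
lemma recursive_lazy_cond:
  assumes "reval c [x] u" "reval f [x] v" "u \<noteq> 0 \<Longrightarrow> reval h [prod_encode (x, u - 1)] w"
  shows "reval (Cnf (Prf (Cnf f [Idf 0]) (Cnf h [Cnf m_pair [Idf 2, Cnf m_pred [Idf 3]]]))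
           [Cnf m_sgn [c], Idf 0, c]) [x] (if u = 0 then v else w)"
proof (rule reval_Cn3)
  show "reval (Cnf m_sgn [c]) [x] (if u = 0 then 0 else 1)"
    by (rule reval_Cn1[OF assms(1) reval_sgn])
  show "reval (Idf 0) [x] x" by (rule reval_proj) auto
  show "reval c [x] u" by (rule assms)
  let ?g = "Cnf h [Cnf m_pair [Idf 2, Cnf m_pred [Idf 3]]]"
  have 0: "reval (Prf (Cnf f [Idf 0]) ?g) [0, x, u] v"
    by (intro reval_Pr0 reval_Cn1[OF _ assms(2)] reval_proj) auto
  have 1: "reval (Prf (Cnf f [Idf 0]) ?g) [Suc 0, x, u] w" if "u \<noteq> 0"
  proof (rule reval_PrS[OF 0])
    show "reval ?g [v, 0, x, u] w"
      by (intro reval_Cn1[OF _ assms(3)[OF that]] reval_Cn2[OF _ _ reval_pair]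
          reval_Cn1[OF _ reval_pred] reval_proj) auto
  qed
  show "reval (Prf (Cnf f [Idf 0]) ?g) [if u = 0 then 0 else 1, x, u] (if u = 0 then v else w)"
    using 0 1 by (cases "u = 0") simp_all
qed

lemma recursive_if [rec_intros]:
  assumes "recursive p" "recursive f" "recursive g"
  shows "recursive (\<lambda>x. if p x then f x else g x)"
proof -
  from assms obtain c d e where c: "\<And>x. reval c [enc x] (enc (p x))"
    and d: "\<And>x. reval d [enc x] (enc (f x))" and e: "\<And>x. reval e [enc x] (enc (g x))"
    unfolding recursive_def by auto
  have "reval (Cnf d [m_fst]) [prod_encode (enc x, u)] (enc (f x))" for x u
    using reval_fst[of "prod_encode (enc x, u)"] d by (auto intro: reval_Cn1)
  then have "reval (Cnf (Prf (Cnf e [Idf 0]) (Cnf (Cnf d [m_fst]) [Cnf m_pair [Idf 2, Cnf m_pred [Idf 3]]]))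
      [Cnf m_sgn [c], Idf 0, c]) [enc x] (if enc (p x) = 0 then enc (g x) else enc (f x))" for x
    by (rule recursive_lazy_cond[OF c e])
  moreover have "(if enc (p x) = 0 then enc (g x) else enc (f x)) = enc (if p x then f x else g x)" for x
    by (simp add: enc_bool_def)
  ultimately show ?thesis by (intro recursiveI) (simp only:)
qed

lemma recursive_case_option [rec_intros]:
  assumes "recursive f" "recursive g" "recursive (\<lambda>y. h (fst y) (snd y))"
  shows "recursive (\<lambda>x. case f x of None \<Rightarrow> g x | Some y \<Rightarrow> h x y)"
proof -
  from assms obtain c d e where c: "\<And>x. reval c [enc x] (enc (f x))"
    and d: "\<And>x. reval d [enc x] (enc (g x))" and e: "\<And>y. reval e [enc y] (enc (h (fst y) (snd y)))"
    unfolding recursive_def by blast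
  let ?m = "Cnf (Prf (Cnf d [Idf 0]) (Cnf e [Cnf m_pair [Idf 2, Cnf m_pred [Idf 3]]])) [Cnf m_sgn [c], Idf 0, c]"
  have "reval ?m [enc x] (enc (case f x of None \<Rightarrow> g x | Some y \<Rightarrow> h x y))" for x
  proof (cases "f x")
    case None
    then show ?thesis
      using recursive_lazy_cond[OF c d, of x e "enc (g x)"] by (simp add: enc_option_def)
  next
    case (Some y)
    then show ?thesis
      using recursive_lazy_cond[OF c d, of x e "enc (h x y)"] e[of "(x, y)"]
      by (simp add: enc_option_def enc_Pair)
  qed
  then show ?thesis by (rule recursiveI)
qed

lemma recursive_case_list [rec_intros]:
  assumes "recursive f" "recursive g" "recursive (\<lambda>y. h (fst y) (fst (snd y)) (snd (snd y)))"
  shows "recursive (\<lambda>x. case f x of [] \<Rightarrow> g x | y # ys \<Rightarrow> h x y ys)"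
proof -
  let ?u = "\<lambda>xs. case xs of [] \<Rightarrow> None | y # ys \<Rightarrow> Some (y, ys)"
  have "enc (?u xs) = enc xs" for xs :: "'b list"
    by (auto simp: enc_option_def enc_list_def enc_Pair split: list.splits)
  then have "recursive (\<lambda>x. ?u (f x))"
    by (rule recursive_recode) (rule assms)
  from this assms(2)
  have "recursive (\<lambda>x. case ?u (f x) of None \<Rightarrow> g x | Some z \<Rightarrow> h x (fst z) (snd z))"
    by (rule recursive_case_option) (use assms(3) in simp)
  then show ?thesis
    by (rule back_subst[of recursive]) (auto simp: fun_eq_iff split: list.splits)
qed

lemma recursive_case_nat [rec_intros]:
  assumes "recursive f" "recursive g" "recursive (\<lambda>y. h (fst y) (snd y))"
  shows "recursive (\<lambda>x. case f x of 0 \<Rightarrow> g x | Suc y \<Rightarrow> h x y)"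
proof -
  let ?u = "\<lambda>n. case n of 0 \<Rightarrow> None | Suc y \<Rightarrow> Some y"
  have "enc (?u n) = enc n" for n :: nat
    by (auto simp: enc_option_def split: nat.splits)
  then have "recursive (\<lambda>x. ?u (f x))"
    by (rule recursive_recode) (rule assms)
  from this assms(2,3)
  have "recursive (\<lambda>x. case ?u (f x) of None \<Rightarrow> g x | Some z \<Rightarrow> h x z)"
    by (rule recursive_case_option)
  then show ?thesis
    by (rule back_subst[of recursive]) (auto simp: fun_eq_iff split: nat.splits)
qed

lemma recursive_congI:
  assumes "recursive g" "\<And>x. f x = g x" shows "recursive f"
proof -
  from assms(2) have "f = g" by (rule ext)
  with assms(1) show ?thesis by simp
qed

lemma recursive_compose2:
  assumes "recursive (\<lambda>y. f (fst y) (snd y))" "recursive h" "recursive k"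
  shows "recursive (\<lambda>x. f (h x) (k x))"
  using recursive_compose[OF assms(1) recursive_Pair[OF assms(2,3)]] by simp

lemma recursive_add [rec_intros]:
  assumes "recursive f" "recursive g" shows "recursive (\<lambda>x. f x + g x :: nat)"
proof (rule recursive_congI)
  show "recursive (\<lambda>x. rec_nat (g x) (\<lambda>_ z. Suc z) (f x))" by (intro rec_intros assms)
  have "rec_nat b (\<lambda>_ z. Suc z) a = a + b" for a b by (induction a) auto
  then show "f x + g x = rec_nat (g x) (\<lambda>_ z. Suc z) (f x)" for x by simp
qed

lemma recursive_diff [rec_intros]:
  assumes "recursive f" "recursive g" shows "recursive (\<lambda>x. f x - g x :: nat)"
proof (rule recursive_congI)
  show "recursive (\<lambda>x. rec_nat (f x) (\<lambda>_ z. z - 1) (g x))" by (intro rec_intros recursive_pred assms)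
  have "rec_nat a (\<lambda>_ z. z - 1) b = a - b" for a b :: nat by (induction b) auto
  then show "f x - g x = rec_nat (f x) (\<lambda>_ z. z - 1) (g x)" for x by simp
qed

lemma recursive_mult2 [rec_intros]:
  assumes "recursive f" shows "recursive (\<lambda>x. 2 * f x :: nat)"
  unfolding mult_2 by (intro rec_intros assms)

lemma recursive_not [rec_intros]:
  assumes "recursive p" shows "recursive (\<lambda>x. \<not> p x)"
proof (rule recursive_congI)
  show "recursive (\<lambda>x. if p x then False else True)" by (intro rec_intros assms)
qed simp

lemma recursive_conj [rec_intros]:
  assumes "recursive p" "recursive q" shows "recursive (\<lambda>x. p x \<and> q x)"
proof (rule recursive_congI)
  show "recursive (\<lambda>x. if p x then q x else False)" by (intro rec_intros assms)
qed simp

lemma recursive_disj [rec_intros]: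
  assumes "recursive p" "recursive q" shows "recursive (\<lambda>x. p x \<or> q x)"
proof (rule recursive_congI)
  show "recursive (\<lambda>x. if p x then True else q x)" by (intro rec_intros assms)
qed simp

lemma recursive_less [rec_intros]:
  assumes "recursive f" "recursive g" shows "recursive (\<lambda>x. (f x :: nat) < g x)"
proof (rule recursive_congI)
  show "recursive (\<lambda>x. case g x - f x of 0 \<Rightarrow> False | Suc _ \<Rightarrow> True)" by (intro rec_intros assms)
qed (auto split: nat.splits)

lemma recursive_eq_nat [rec_intros]:
  assumes "recursive f" "recursive g" shows "recursive (\<lambda>x. (f x :: nat) = g x)"
proof (rule recursive_congI)
  show "recursive (\<lambda>x. \<not> f x < g x \<and> \<not> g x < f x)" by (intro rec_intros assms)
qed auto

lemma recursive_even [rec_intros]: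
  assumes "recursive f" shows "recursive (\<lambda>x. even (f x :: nat))"
proof (rule recursive_congI)
  show "recursive (\<lambda>x. rec_nat True (\<lambda>_ b. \<not> b) (f x))" by (intro rec_intros assms)
  have "rec_nat True (\<lambda>_ b. \<not> b) n = even n" for n by (induction n) auto
  then show "even (f x) = rec_nat True (\<lambda>_ b. \<not> b) (f x)" for x by simp
qed

lemma recursive_half [rec_intros]:
  assumes "recursive f" shows "recursive (\<lambda>x. (f x :: nat) div 2)"
proof (rule recursive_congI)
  show "recursive (\<lambda>x. rec_nat 0 (\<lambda>n z. if even n then z else Suc z) (f x))" by (intro rec_intros assms)
  have "rec_nat 0 (\<lambda>n z. if even n then z else Suc z) n = n div 2" for n by (induction n) auto
  then show "f x div 2 = rec_nat 0 (\<lambda>n z. if even n then z else Suc z) (f x)" for x by simp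
qed

lemma recursive_is_None [rec_intros]:
  assumes "recursive f" shows "recursive (\<lambda>x. f x = None)"
proof (rule recursive_congI)
  show "recursive (\<lambda>x. case f x of None \<Rightarrow> True | Some _ \<Rightarrow> False)" by (intro rec_intros assms)
qed (auto split: option.splits)

lemma recursive_is_Nil [rec_intros]:
  assumes "recursive f" shows "recursive (\<lambda>x. f x = [])"
proof (rule recursive_congI)
  show "recursive (\<lambda>x. case f x of [] \<Rightarrow> True | _ # _ \<Rightarrow> False)" by (intro rec_intros assms)
qed (auto split: list.splits)

section \<open>List access and bounded search\<close>

lemma recursive_drop [rec_intros]:
  assumes "recursive f" "recursive g" shows "recursive (\<lambda>x. drop (g x) (f x))"
proof (rule recursive_congI)
  show "recursive (\<lambda>x. rec_nat (f x) (\<lambda>_ ys. case ys of [] \<Rightarrow> [] | _ # zs \<Rightarrow> zs) (g x))"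
    by (intro rec_intros assms)
  have "rec_nat xs (\<lambda>_ ys. case ys of [] \<Rightarrow> [] | _ # zs \<Rightarrow> zs) n = drop n xs" for xs :: "'b list" and n
  proof (induction n)
    case (Suc n)
    have "drop (Suc n) xs = tl (drop n xs)" by (simp add: drop_Suc tl_drop)
    with Suc show ?case by (simp split: list.splits)
  qed simp
  then show "drop (g x) (f x) = rec_nat (f x) (\<lambda>_ ys. case ys of [] \<Rightarrow> [] | _ # zs \<Rightarrow> zs) (g x)" for x
    by simp
qed

text \<open>Supplies a computable bound for the recursion that counts the elements of a
  list.\<close>

lemma length_le_enc: "length xs \<le> enc xs"
proof (induction xs)
  case (Cons y ys)
  then show ?case using le_prod_encode_2[of "enc ys" "enc y"] by (simp add: enc_Cons)
qed simp

lemma recursive_length [rec_intros]: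
  assumes "recursive f" shows "recursive (\<lambda>x. length (f x))"
proof (rule recursive_congI)
  let ?l = "\<lambda>xs. rec_nat 0 (\<lambda>i z. if drop i xs = [] then z else Suc z)"
  show "recursive (\<lambda>x. ?l (f x) (enc (f x)))" by (intro rec_intros assms[THEN recursive_compose])
  have "?l xs n = min n (length xs)" for xs :: "'b list" and n by (induction n) auto
  then show "length (f x) = ?l (f x) (enc (f x))" for x
    using length_le_enc[of "f x"] by (simp add: min_def)
qed

text \<open>\<open>xs ! i\<close> is unspecified beyond the end of the list; the option makes that
  case an explicit answer, which the searches on finite prefixes rely on.\<close>

definition lookup :: "'a list \<Rightarrow> nat \<Rightarrow> 'a option" where
  "lookup xs i = (if i < length xs then Some (xs ! i) else None)"

lemma lookup_drop: "lookup xs i = (case drop i xs of [] \<Rightarrow> None | y # _ \<Rightarrow> Some y)"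
proof (cases "i < length xs")
  case True
  then show ?thesis by (simp add: lookup_def Cons_nth_drop_Suc[symmetric])
qed (simp add: lookup_def)

lemma recursive_lookup [rec_intros]:
  assumes "recursive f" "recursive g" shows "recursive (\<lambda>x. lookup (f x) (g x))"
  unfolding lookup_drop by (intro rec_intros assms)

lemma recursive_map_upt [rec_intros]:
  assumes "recursive (\<lambda>y. f (fst y) (snd y))" "recursive g"
  shows "recursive (\<lambda>x. map (f x) [0..<g x])"
proof (rule recursive_congI)
  \<comment> \<open>Consing from the last index downwards gives the list in increasing order without
    a reversal.\<close>
  show "recursive (\<lambda>x. rec_nat [] (\<lambda>j acc. f x (g x - Suc j) # acc) (g x))"
    by (intro rec_intros recursive_compose2[OF assms(1)] assms(2)[THEN recursive_compose])
  have "rec_nat [] (\<lambda>j acc. h (n - Suc j) # acc) j = map h [n - j..<n]" if "j \<le> n" for h :: "nat \<Rightarrow> 'b" and n j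
    using that
  proof (induction j)
    case (Suc j)
    then have "[n - Suc j..<n] = (n - Suc j) # [n - j..<n]"
      using upt_conv_Cons[of "n - Suc j" n] by (simp add: Suc_diff_Suc)
    with Suc show ?case by simp
  qed simp
  from this[of "g x" "g x" "f x" for x]
  show "map (f x) [0..<g x] = rec_nat [] (\<lambda>j acc. f x (g x - Suc j) # acc) (g x)" for x
    by simp
qed

lemma recursive_take [rec_intros]:
  assumes "recursive f" "recursive g" shows "recursive (\<lambda>x. take (g x) (f x :: nat list))"
proof (rule recursive_congI)
  \<comment> \<open>The default 0 is never reached, since the range is cut off at the length of the
    list.\<close>
  show "recursive (\<lambda>x. map (\<lambda>i. case lookup (f x) i of None \<Rightarrow> 0 | Some y \<Rightarrow> y)
      [0..<if g x < length (f x) then g x else length (f x)])"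
    by (intro rec_intros assms recursive_compose[OF assms(1)])
qed (auto intro!: nth_equalityI simp: lookup_def)

text \<open>The bounded, hence total, counterpart of minimization: the answer at the least index
  below \<open>N\<close> that has one.\<close>

definition bfind :: "(nat \<Rightarrow> 'a option) \<Rightarrow> nat \<Rightarrow> 'a option" where
  "bfind f N = rec_nat None (\<lambda>j z. case z of None \<Rightarrow> f j | Some v \<Rightarrow> Some v) N"

lemma bfind_0 [simp]: "bfind f 0 = None"
  and bfind_Suc [simp]: "bfind f (Suc n) = (case bfind f n of None \<Rightarrow> f n | Some v \<Rightarrow> Some v)"
  by (simp_all add: bfind_def)

lemma bfind_None: "bfind f N = None \<longleftrightarrow> (\<forall>j<N. f j = None)"
  by (induction N) (auto simp: less_Suc_eq split: option.splits)

lemma bfind_definedI: "j < N \<Longrightarrow> f j \<noteq> None \<Longrightarrow> bfind f N \<noteq> None"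
  by (auto simp: bfind_None)

lemma bfind_Some: "bfind f N = Some v \<longleftrightarrow> (\<exists>j<N. f j = Some v \<and> (\<forall>i<j. f i = None))"
proof (induction N)
  case (Suc N)
  show ?case
  proof (cases "bfind f N")
    case None
    then have "\<forall>j<N. f j = None" by (simp add: bfind_None)
    with None show ?thesis by (auto simp: less_Suc_eq)
  next
    case (Some w)
    with Suc show ?thesis by (auto simp: less_Suc_eq bfind_None) (metis bfind_None option.distinct(1))
  qed
qed simp

lemma recursive_bfind [rec_intros]:
  assumes "recursive (\<lambda>y. f (fst y) (snd y))" "recursive g"
  shows "recursive (\<lambda>x. bfind (f x) (g x))"
  unfolding bfind_def by (intro rec_intros recursive_compose2[OF assms(1)] assms(2))

lemma recursive_ex_less [rec_intros]:
  fixes p :: "'a::coded \<Rightarrow> nat \<Rightarrow> bool"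
  assumes "recursive (\<lambda>y. p (fst y) (snd y))" "recursive g"
  shows "recursive (\<lambda>x. \<exists>i<g x. p x i)"
proof (rule recursive_congI)
  show "recursive (\<lambda>x. \<not> bfind (\<lambda>i. if p x i then Some i else None) (g x) = None)"
    by (intro rec_intros recursive_compose2[OF assms(1)] assms(2))
qed (auto simp: bfind_None)

section \<open>Time-bounded simulation of partial recursive functions\<close>

text \<open>The first argument \<open>w\<close> of \<open>T\<close> is the time bound. Completeness
  asks for the answer at all large \<open>w\<close>, not just at some \<open>w\<close>: finitely
  many subcomputations can then share one bound, and no monotonicity of \<open>T\<close> in
  \<open>w\<close> has to be maintained.\<close>

definition simulates :: "(nat \<times> nat list \<Rightarrow> nat option) \<Rightarrow> recf \<Rightarrow> bool" where
  "simulates T c \<longleftrightarrow> recursive T \<and>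
     (\<forall>w xs v. T (w, xs) = Some v \<longrightarrow> reval c xs v) \<and>
     (\<forall>xs v. reval c xs v \<longrightarrow> (\<forall>\<^sub>F w in sequentially. T (w, xs) = Some v))"

lemma simulatesI:
  assumes "recursive T" "\<And>w xs v. T (w, xs) = Some v \<Longrightarrow> reval c xs v"
    and "\<And>xs v. reval c xs v \<Longrightarrow> \<forall>\<^sub>F w in sequentially. T (w, xs) = Some v"
  shows "simulates T c"
  using assms unfolding simulates_def by simp

lemma simulates_recursive: "simulates T c \<Longrightarrow> recursive T"
  by (simp add: simulates_def)

inductive_cases reval_ZfE: "reval Zf xs v"
inductive_cases reval_SfE: "reval Sf xs v"
inductive_cases reval_IdfE: "reval (Idf k) xs v"
inductive_cases reval_CnfE: "reval (Cnf f gs) xs v"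
inductive_cases reval_PrfE: "reval (Prf f g) xs v"
inductive_cases reval_PrfSucE: "reval (Prf f g) (Suc n # xs) v"
inductive_cases reval_Prf0E: "reval (Prf f g) (0 # xs) v"
inductive_cases reval_MnfE: "reval (Mnf f) xs v"

lemma simulates_Zf: "simulates (\<lambda>_. Some 0) Zf"
  unfolding simulates_def by (auto intro!: rec_intros reval_Z elim: reval_ZfE)

lemma simulates_Sf: "simulates (\<lambda>y. case snd y of [] \<Rightarrow> None | x # _ \<Rightarrow> Some (Suc x)) Sf"
  unfolding simulates_def by (auto intro!: rec_intros intro: reval_S elim: reval_SfE split: list.splits)

lemma simulates_Idf: "simulates (\<lambda>y. lookup (snd y) k) (Idf k)"
  unfolding simulates_def
  by (intro conjI rec_intros) (auto intro: reval_Id elim!: reval_IdfE simp: lookup_def split: if_splits)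

text \<open>Bundles the arguments of a composition into one simulation, whose answer is the list of
  their values.\<close>

lemma simulates_list:
  assumes "\<And>g. g \<in> set gs \<Longrightarrow> \<exists>T. simulates T g"
  shows "\<exists>U :: nat \<times> nat list \<Rightarrow> nat list option. recursive U \<and>
    (\<forall>w xs ys. U (w, xs) = Some ys \<longrightarrow> list_all2 (\<lambda>g y. reval g xs y) gs ys) \<and>
    (\<forall>xs ys. list_all2 (\<lambda>g y. reval g xs y) gs ys \<longrightarrow> (\<forall>\<^sub>F w in sequentially. U (w, xs) = Some ys))"
  using assms
proof (induction gs)
  case Nil
  show ?case by (rule exI[where x = "\<lambda>_. Some []"]) (auto intro: rec_intros)
next
  case (Cons g gs)
  then obtain U where U: "recursive U"
    "\<And>w xs ys. U (w, xs) = Some ys \<Longrightarrow> list_all2 (\<lambda>g y. reval g xs y) gs ys"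
    "\<And>xs ys. list_all2 (\<lambda>g y. reval g xs y) gs ys \<Longrightarrow> (\<forall>\<^sub>F w in sequentially. U (w, xs) = Some ys)"
    by auto
  from Cons.prems obtain T where T: "simulates T g" by auto
  let ?V = "\<lambda>y. case T y of None \<Rightarrow> None | Some v \<Rightarrow> (case U y of None \<Rightarrow> None | Some vs \<Rightarrow> Some (v # vs))"
  have "recursive ?V"
    by (intro rec_intros U(1)[THEN recursive_compose] U(1) simulates_recursive[OF T])
  moreover have "list_all2 (\<lambda>g y. reval g xs y) (g # gs) ys" if "?V (w, xs) = Some ys" for w xs ys
    using that T U(2) by (auto simp: simulates_def split: option.splits)
  moreover have "\<forall>\<^sub>F w in sequentially. ?V (w, xs) = Some ys"
    if "list_all2 (\<lambda>g y. reval g xs y) (g # gs) ys" for xs ys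
  proof -
    from that obtain v vs where v: "ys = v # vs" "reval g xs v" "list_all2 (\<lambda>g y. reval g xs y) gs vs"
      by (auto simp: list_all2_Cons1)
    have "\<forall>\<^sub>F w in sequentially. T (w, xs) = Some v" using T v by (simp add: simulates_def)
    moreover have "\<forall>\<^sub>F w in sequentially. U (w, xs) = Some vs" using U v by simp
    ultimately show ?thesis by eventually_elim (simp add: v)
  qed
  ultimately show ?case by blast
qed

lemma simulates_Cnf:
  assumes "simulates T f" "\<And>g. g \<in> set gs \<Longrightarrow> \<exists>T. simulates T g"
  shows "\<exists>T. simulates T (Cnf f gs)"
proof -
  have "\<exists>T. simulates T g" if "g \<in> set gs" for g by (rule assms(2)[OF that])
  from simulates_list[of gs, OF this] obtain U where U: "recursive U"
    "\<And>w xs ys. U (w, xs) = Some ys \<Longrightarrow> list_all2 (\<lambda>g y. reval g xs y) gs ys"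
    "\<And>xs ys. list_all2 (\<lambda>g y. reval g xs y) gs ys \<Longrightarrow> (\<forall>\<^sub>F w in sequentially. U (w, xs) = Some ys)"
    by auto
  note T = assms(1)[unfolded simulates_def]
  let ?V = "\<lambda>y. case U y of None \<Rightarrow> None | Some ys \<Rightarrow> T (fst y, ys)"
  have "recursive ?V" 
    by (intro rec_intros recursive_compose[OF conjunct1[OF T]] U(1))
  moreover have "reval (Cnf f gs) xs v" if "?V (w, xs) = Some v" for w xs v
  proof -
    from that obtain ys where ys: "U (w, xs) = Some ys" "T (w, ys) = Some v" by (auto split: option.splits)
    show ?thesis by (rule reval_Cn[OF U(2)[OF ys(1)]]) (use T ys in blast)
  qed
  moreover have "\<forall>\<^sub>F w in sequentially. ?V (w, xs) = Some v" if "reval (Cnf f gs) xs v" for xs v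
  proof -
    from that obtain ys where ys: "list_all2 (\<lambda>g y. reval g xs y) gs ys" "reval f ys v"
      by (erule reval_CnfE)
    have "\<forall>\<^sub>F w in sequentially. T (w, ys) = Some v" using T ys by simp
    moreover have "\<forall>\<^sub>F w in sequentially. U (w, xs) = Some ys" using U ys by simp
    ultimately show ?thesis by eventually_elim simp
  qed
  ultimately have "simulates ?V (Cnf f gs)" by (rule simulatesI)
  then show ?thesis by blast
qed

lemma simulates_Prf:
  assumes T: "simulates T f" and U: "simulates U g"
  shows "\<exists>T. simulates T (Prf f g)"
proof -
  let ?r = "\<lambda>w xs. rec_nat (T (w, xs)) (\<lambda>n z. case z of None \<Rightarrow> None | Some z \<Rightarrow> U (w, z # n # xs))"
  let ?V = "\<lambda>y. case snd y of [] \<Rightarrow> None | n # xs \<Rightarrow> ?r (fst y) xs n"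
  have rec: "recursive ?V"
    by (intro rec_intros T[THEN simulates_recursive, THEN recursive_compose]
        U[THEN simulates_recursive, THEN recursive_compose])
  have sound: "reval (Prf f g) (n # xs) v" if "?r w xs n = Some v" for w n xs v
    using that
  proof (induction n arbitrary: v)
    case 0
    then show ?case using T by (auto simp: simulates_def intro: reval_Pr0)
  next
    case (Suc n)
    then obtain z where "?r w xs n = Some z" and z: "U (w, z # n # xs) = Some v"
      by (auto split: option.splits)
    from Suc.IH[OF this(1)] have "reval (Prf f g) (n # xs) z" .
    moreover from z U have "reval g (z # n # xs) v" unfolding simulates_def by blast
    ultimately show ?case by (rule reval_PrS)
  qed
  have cpl: "\<forall>\<^sub>F w in sequentially. ?r w xs n = Some v" if "reval (Prf f g) (n # xs) v" for n xs v
    using that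
  proof (induction n arbitrary: v)
    case 0
    then show ?case using T by (auto simp: simulates_def elim: reval_Prf0E)
  next
    case (Suc n)
    from Suc.prems obtain z where z: "reval (Prf f g) (n # xs) z" "reval g (z # n # xs) v"
      by (erule reval_PrfSucE)
    have "\<forall>\<^sub>F w in sequentially. U (w, z # n # xs) = Some v" using U z by (simp add: simulates_def)
    with Suc.IH[OF z(1)] show ?case by eventually_elim simp
  qed
  then have "\<forall>\<^sub>F w in sequentially. ?V (w, xs) = Some v" if "reval (Prf f g) xs v" for xs v
  proof -
    have "\<exists>n ys. xs = n # ys" by (rule reval_PrfE[OF that]) auto
    then show ?thesis using cpl that by auto
  qed
  moreover have "reval (Prf f g) xs v" if "?V (w, xs) = Some v" for w xs v
    using that unfolding fst_conv snd_conv by (cases xs) (auto dest: sound)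
  ultimately have "simulates ?V (Prf f g)" by (intro simulatesI[OF rec])
  then show ?thesis by blast
qed

lemma simulates_Mnf:
  assumes T: "simulates T f"
  shows "\<exists>T. simulates T (Mnf f)"
proof -
  \<comment> \<open>The search stops at a zero and also at a candidate where \<open>T\<close> has
    not answered yet: passing over the latter could return a zero with an undefined predecessor. The
    test in \<open>?V\<close> then keeps only stops at a zero.\<close>
  let ?p = "\<lambda>w xs n. case T (w, n # xs) of None \<Rightarrow> Some n | Some v \<Rightarrow> (case v of 0 \<Rightarrow> Some n | Suc _ \<Rightarrow> None)"
  let ?V = "\<lambda>y. case bfind (?p (fst y) (snd y)) (fst y) of None \<Rightarrow> None
     | Some n \<Rightarrow> (case T (fst y, n # snd y) of None \<Rightarrow> None | Some v \<Rightarrow> (if v = 0 then Some n else None))"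
  have "recursive ?V"
    by (intro rec_intros T[THEN simulates_recursive, THEN recursive_compose])
  moreover have "reval (Mnf f) xs n" if V: "?V (w, xs) = Some n" for w n xs
  proof -
    from V have 0: "T (w, n # xs) = Some 0" and b: "bfind (?p w xs) w = Some n"
      by (auto split: option.splits if_splits)
    have "\<exists>v. T (w, m # xs) = Some v \<and> v \<noteq> 0" if "m < n" for m
    proof -
      from b have "\<exists>j. ?p w xs j = Some n \<and> (\<forall>i<j. ?p w xs i = None)" by (auto simp: bfind_Some)
      then obtain j where j: "?p w xs j = Some n" "\<forall>i<j. ?p w xs i = None" by blast
      from j(1) have "j = n" by (auto split: option.splits nat.splits)
      with j(2) that have "?p w xs m = None" by blast
      then show ?thesis by (auto split: option.splits nat.splits)
    qed
    with 0 T show ?thesis by (intro reval_Mn) (auto simp: simulates_def, metis)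
  qed
  moreover have "\<forall>\<^sub>F w in sequentially. ?V (w, xs) = Some n" if "reval (Mnf f) xs n" for n xs
  proof -
    from that have "reval f (n # xs) 0" and "\<forall>m<n. \<exists>v. reval f (m # xs) v \<and> v \<noteq> 0"
      by (auto elim: reval_MnfE)
    then obtain g where g: "\<And>m. m < n \<Longrightarrow> reval f (m # xs) (g m) \<and> g m \<noteq> 0" by metis
    have "\<forall>\<^sub>F w in sequentially. \<forall>m\<in>{..<n}. T (w, m # xs) = Some (g m)"
      by (rule eventually_ball_finite) (use g T in \<open>auto simp: simulates_def\<close>)
    moreover have "\<forall>\<^sub>F w in sequentially. T (w, n # xs) = Some 0"
      using T \<open>reval f (n # xs) 0\<close> by (simp add: simulates_def)
    \<comment> \<open>The time bound is also the range of the search, so it has to exceed the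
      result.\<close>
    moreover have "\<forall>\<^sub>F w in sequentially. n < w" by (rule eventually_gt_at_top)
    ultimately show ?thesis
    proof eventually_elim
      case (elim w)
      have "?p w xs n = Some n" using elim by simp
      moreover have "?p w xs m = None" if "m < n" for m
        using elim(1) g[OF that] that by (auto split: nat.splits)
      ultimately have "bfind (?p w xs) w = Some n" unfolding bfind_Some using elim by blast
      then show ?case using elim by simp
    qed
  qed
  ultimately have "simulates ?V (Mnf f)" by (rule simulatesI)
  then show ?thesis by blast
qed

lemma simulates_exists: "\<exists>T. simulates T c"
proof (induction c)
  case Zf
  show ?case by (rule exI) (rule simulates_Zf)
next
  case Sf
  show ?case by (rule exI) (rule simulates_Sf)
next
  case (Idf k)
  show ?case by (rule exI) (rule simulates_Idf)
next
  case (Cnf f gs)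
  then obtain T where "simulates T f" by blast
  then show ?case by (rule simulates_Cnf) (rule Cnf)
next
  case (Prf f g)
  then show ?case by (elim exE) (rule simulates_Prf)
next
  case (Mnf f)
  then show ?case by (elim exE) (rule simulates_Mnf)
qed

text \<open>Both values are eventually the output of one and the same function \<open>T\<close>.
  This spares an induction over \<open>reval\<close> with its nested lists and its minimization
  clause.\<close>

lemma reval_deterministic:
  assumes "reval c xs v" "reval c xs v'" shows "v = v'"
proof -
  obtain T where T: "simulates T c" using simulates_exists by blast
  have "\<forall>\<^sub>F w in sequentially. T (w, xs) = Some v" "\<forall>\<^sub>F w in sequentially. T (w, xs) = Some v'"
    using T assms by (auto simp: simulates_def)
  then have "\<forall>\<^sub>F w :: nat in sequentially. v = v'" by eventually_elim simp
  then show ?thesis by simp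
qed

section \<open>Computable functions on Baire space\<close>

lemma recursive_list_encode [rec_intros]:
  "recursive f \<Longrightarrow> recursive (\<lambda>x. list_encode (f x))"
  by (rule recursive_recode) (simp_all add: enc_nat_list)

lemma recursive_list_decode [rec_intros]:
  "recursive f \<Longrightarrow> recursive (\<lambda>x. list_decode (f x))"
  by (rule recursive_recode) (simp_all add: enc_nat_list)

lemma recursive_prod_encode [rec_intros]:
  "recursive f \<Longrightarrow> recursive (\<lambda>x. prod_encode (f x))"
  by (rule recursive_recode) (simp_all add: enc_prod_def)

lemma recursive_prod_decode [rec_intros]:
  "recursive f \<Longrightarrow> recursive (\<lambda>x. prod_decode (f x))"
  by (rule recursive_recode) (simp_all add: enc_prod_def)

abbreviation prefix :: "baire \<Rightarrow> nat \<Rightarrow> nat list" where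
  "prefix p k \<equiv> map p [0..<k]"

lemma take_prefix: "j \<le> k \<Longrightarrow> take j (prefix p k) = prefix p j"
  by (simp add: take_map)

lemma lookup_prefix: "lookup (prefix p k) i = (if i < k then Some (p i) else None)"
  by (simp add: lookup_def)

definition value_or_0 :: "nat option \<Rightarrow> nat" where
  "value_or_0 z = (case z of None \<Rightarrow> 0 | Some v \<Rightarrow> v)"

lemma value_or_0_Some [simp]: "value_or_0 (Some v) = v"
  by (simp add: value_or_0_def)

lemma recursive_value_or_0 [rec_intros]: "recursive f \<Longrightarrow> recursive (\<lambda>x. value_or_0 (f x))"
  unfolding value_or_0_def by (intro rec_intros)

text \<open>Strengthens \<open>computable_b\<close> in two ways: \<open>\<Phi>\<close> is total, and
  it answers on all sufficiently long prefixes, so that one prefix can serve finitely many queries.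
  For \<open>p\<close> outside the domain of \<open>F\<close> nothing is said about the
  answers.\<close>

definition approximates :: "(nat \<times> nat list \<Rightarrow> nat option) \<Rightarrow> (baire \<Rightarrow> baire option) \<Rightarrow> bool" where
  "approximates \<Phi> F \<longleftrightarrow> recursive \<Phi> \<and> (\<forall>p q. F p = Some q \<longrightarrow> (\<forall>n.
     (\<forall>k v. \<Phi> (n, prefix p k) = Some v \<longrightarrow> v = q n) \<and>
     (\<forall>\<^sub>F k in sequentially. \<Phi> (n, prefix p k) \<noteq> None)))"

lemma approximatesI:
  assumes "recursive \<Phi>"
    and "\<And>p q n k v. F p = Some q \<Longrightarrow> \<Phi> (n, prefix p k) = Some v \<Longrightarrow> v = q n"
    and "\<And>p q n. F p = Some q \<Longrightarrow> \<forall>\<^sub>F k in sequentially. \<Phi> (n, prefix p k) \<noteq> None"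
  shows "approximates \<Phi> F"
  using assms unfolding approximates_def by blast

lemma approximates_recursive: "approximates \<Phi> F \<Longrightarrow> recursive \<Phi>"
  and approximates_sound: "approximates \<Phi> F \<Longrightarrow> F p = Some q \<Longrightarrow> \<Phi> (n, prefix p k) = Some v \<Longrightarrow> v = q n"
  and approximates_defined:
    "approximates \<Phi> F \<Longrightarrow> F p = Some q \<Longrightarrow> \<forall>\<^sub>F k in sequentially. \<Phi> (n, prefix p k) \<noteq> None"
  unfolding approximates_def by blast+

lemma approximates_eventually:
  assumes "approximates \<Phi> F" "F p = Some q"
  shows "\<forall>\<^sub>F k in sequentially. \<Phi> (n, prefix p k) = Some (q n)"
  using approximates_defined[OF assms, of n]
  by eventually_elim (use approximates_sound[OF assms] in auto)

text \<open>Excludes false confirmations: if the output is the zero sequence, no prefix, however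
  short, yields a nonzero value.\<close>

lemma approximates_zero:
  assumes "approximates \<Phi> F" "F p = Some (\<lambda>_. 0)"
  shows "value_or_0 (\<Phi> (n, prefix p k)) = 0"
proof (cases "\<Phi> (n, prefix p k)")
  case (Some v)
  from approximates_sound[OF assms this] Some show ?thesis by simp
qed (simp add: value_or_0_def)

lemma computable_b_approximates:
  assumes "computable_b F" shows "\<exists>\<Phi>. approximates \<Phi> F"
proof -
  from assms obtain c where c: "\<And>p q n. F p = Some q \<Longrightarrow> \<exists>k v. reval c [n, prefix_code p k] v"
      "\<And>p q n k v. F p = Some q \<Longrightarrow> reval c [n, prefix_code p k] v \<Longrightarrow> v = q n"
    unfolding computable_b_def by blast
  obtain T where T: "simulates T c" using simulates_exists by blast
  \<comment> \<open>The length of the available prefix bounds both the running time and the shorter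
    prefixes that are tried. One answer of the machine on one prefix thus turns into an answer on
    all sufficiently long prefixes.\<close>
  let ?\<Phi> = "\<lambda>y. bfind (\<lambda>j. T (length (snd y), [fst y, list_encode (take j (snd y))])) (Suc (length (snd y)))"
  have step: "T (length (prefix p k), [n, list_encode (take j (prefix p k))]) = T (k, [n, prefix_code p j])"
    if "j \<le> k" for p n j k
    using take_prefix[OF that, of p] by (simp add: prefix_code_def)
  have "approximates ?\<Phi> F"
  proof (rule approximatesI)
    show "recursive ?\<Phi>"
      by (intro rec_intros T[THEN simulates_recursive, THEN recursive_compose])
  next
    fix p q n k v assume F: "F p = Some q" and "?\<Phi> (n, prefix p k) = Some v"
    then obtain j where "j < Suc k" "T (length (prefix p k), [n, list_encode (take j (prefix p k))]) = Some v"
      unfolding bfind_Some fst_conv snd_conv by auto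
    then have "T (k, [n, prefix_code p j]) = Some v" using step[of j k p n] by simp
    then have "reval c [n, prefix_code p j] v" using T by (simp add: simulates_def)
    with c(2) F show "v = q n" by blast
  next
    fix p q n assume F: "F p = Some q"
    from c(1)[OF F, of n] obtain k0 v0 where "reval c [n, prefix_code p k0] v0" by blast
    then have "\<forall>\<^sub>F k in sequentially. T (k, [n, prefix_code p k0]) = Some v0"
      using T by (simp add: simulates_def)
    then show "\<forall>\<^sub>F k in sequentially. ?\<Phi> (n, prefix p k) \<noteq> None"
      using eventually_ge_at_top[of k0]
    proof eventually_elim
      case (elim k)
      then have "T (length (prefix p k), [n, list_encode (take k0 (prefix p k))]) \<noteq> None"
        using step[of k0 k p n] by simp
      moreover have "k0 < Suc (length (prefix p k))" using elim by simp
      ultimately show ?case unfolding fst_conv snd_conv by (intro bfind_definedI)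
    qed
  qed
  then show ?thesis by blast
qed

text \<open>Partial inverse of the successor: it searches for a zero of the distance between
  \<open>u\<close> and \<open>m + 1\<close>. It diverges at 0, the code of \<open>None\<close>, and
  so turns an optional answer back into a partial one.\<close>

definition m_unSuc :: recf where
  "m_unSuc = Mnf (Cnf m_add [Cnf m_sub [Cnf Sf [Idf 0], Idf 1], Cnf m_sub [Idf 1, Cnf Sf [Idf 0]]])"

lemma reval_unSuc: "reval m_unSuc [u] v \<longleftrightarrow> u = Suc v"
proof -
  let ?D = "Cnf m_add [Cnf m_sub [Cnf Sf [Idf 0], Idf 1], Cnf m_sub [Idf 1, Cnf Sf [Idf 0]]]"
  have D: "reval ?D [m, u] ((u - Suc m) + (Suc m - u))" for m
    by (intro reval_Cn2[OF _ _ reval_add] reval_Cn2[OF _ _ reval_sub] reval_Cn1[OF _ reval_S] reval_proj) auto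
  show ?thesis
  proof
    assume "reval m_unSuc [u] v"
    then have "reval ?D [v, u] 0" unfolding m_unSuc_def by (auto elim: reval_MnfE)
    from reval_deterministic[OF D this] show "u = Suc v" by auto
  next
    assume u: "u = Suc v"
    show "reval m_unSuc [u] v" unfolding m_unSuc_def
    proof (rule reval_Mn)
      show "reval ?D [v, u] 0" using D[of v] u by simp
      show "\<forall>m<v. \<exists>w. reval ?D [m, u] w \<and> w \<noteq> 0"
      proof (intro allI impI)
        fix m assume "m < v"
        then have "(u - Suc m) + (Suc m - u) \<noteq> 0" using u by simp
        then show "\<exists>w. reval ?D [m, u] w \<and> w \<noteq> 0" using D by blast
      qed
    qed
  qed
qed

lemma approximates_computable_b:
  assumes "approximates \<Phi> F" shows "computable_b F"
proof -
  obtain c where c: "\<And>z. reval c [enc z] (enc (\<Phi> z))"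
    using recursiveE[OF assms[THEN approximates_recursive]] by blast
  let ?m = "Cnf c [Cnf m_pair [Idf 0, Idf 1]]"
  have m: "reval ?m [n, prefix_code p k] (enc (\<Phi> (n, prefix p k)))" for n p k
  proof (intro reval_Cn1)
    show "reval (Cnf m_pair [Idf 0, Idf 1]) [n, prefix_code p k] (enc (n, prefix p k))"
      unfolding enc_Pair enc_nat_list prefix_code_def
      by (intro reval_Cn2[OF _ _ reval_pair] reval_proj) auto
  qed (rule c)
  have M: "reval (Cnf m_unSuc [?m]) [n, prefix_code p k] v \<longleftrightarrow> \<Phi> (n, prefix p k) = Some v" for n p k v
  proof
    assume "reval (Cnf m_unSuc [?m]) [n, prefix_code p k] v"
    then obtain ys where ys: "list_all2 (\<lambda>g. reval g [n, prefix_code p k]) [?m] ys" "reval m_unSuc ys v"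
      by (erule reval_CnfE)
    then obtain u where u: "ys = [u]" "reval ?m [n, prefix_code p k] u"
      by (auto simp: list_all2_Cons1)
    with reval_deterministic[OF m] ys(2) have "enc (\<Phi> (n, prefix p k)) = Suc v"
      by (simp add: reval_unSuc)
    then show "\<Phi> (n, prefix p k) = Some v"
      by (simp add: enc_option_def split: option.splits)
  next
    assume "\<Phi> (n, prefix p k) = Some v"
    with m[of n p k] have "reval ?m [n, prefix_code p k] (Suc v)" by (simp add: enc_option_def)
    then show "reval (Cnf m_unSuc [?m]) [n, prefix_code p k] v"
      by (rule reval_Cn1) (simp add: reval_unSuc)
  qed
  show ?thesis
    unfolding computable_b_def
  proof (intro exI[of _ "Cnf m_unSuc [?m]"] allI impI conjI)
    fix p q n assume F: "F p = Some q"
    from approximates_eventually[OF assms, OF F, of n]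
    have "\<exists>k. \<Phi> (n, prefix p k) = Some (q n)" by (auto simp: eventually_sequentially)
    then show "\<exists>k v. reval (Cnf m_unSuc [?m]) [n, prefix_code p k] v" unfolding M by blast
  next
    fix p q n k v assume "F p = Some q" "reval (Cnf m_unSuc [?m]) [n, prefix_code p k] v"
    then show "v = q n" unfolding M using approximates_sound[OF assms] by blast
  qed
qed

lemma computable_b_subst:
  assumes "recursive h" shows "computable_b (\<lambda>p. Some (\<lambda>n. p (h n)))"
proof (rule approximates_computable_b[OF approximatesI])
  show "recursive (\<lambda>y. lookup (snd y) (h (fst y)))"
    by (intro rec_intros assms[THEN recursive_compose])
next
  fix p q :: baire and n
  assume "Some (\<lambda>n. p (h n)) = Some q"
  show "\<forall>\<^sub>F k in sequentially. lookup (snd (n, prefix p k)) (h (fst (n, prefix p k))) \<noteq> None"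
    using eventually_gt_at_top[of "h n"] by eventually_elim (simp add: lookup_prefix)
qed (auto simp: lookup_prefix split: if_splits)

lemma computable_b_lft: "computable_b (\<lambda>p. Some (lft p))"
  unfolding lft_def by (intro computable_b_subst rec_intros)

lemma computable_b_rgt: "computable_b (\<lambda>p. Some (rgt p))"
  unfolding rgt_def by (intro computable_b_subst rec_intros)

lemma computable_b_compose:
  assumes "computable_b F" "computable_b G"
  shows "computable_b (\<lambda>p. Option.bind (G p) F)"
proof -
  obtain \<Phi> where \<Phi>: "approximates \<Phi> F" using computable_b_approximates assms(1) by blast
  obtain \<Gamma> where \<Gamma>: "approximates \<Gamma> G" using computable_b_approximates assms(2) by blast
  \<comment> \<open>A prefix of length \<open>l\<close> of the intermediate sequence is available
    only if \<open>\<Gamma>\<close> answers at all \<open>l\<close> positions. The length that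
    \<open>\<Phi>\<close> needs is unknown, so all lengths up to that of the input are
    tried.\<close>
  let ?try = "\<lambda>y l. if \<exists>i<l. \<Gamma> (i, snd y) = None then None
    else \<Phi> (fst y, map (\<lambda>i. value_or_0 (\<Gamma> (i, snd y))) [0..<l])"
  let ?\<Theta> = "\<lambda>y. bfind (?try y) (Suc (length (snd y)))"
  show ?thesis
  proof (rule approximates_computable_b[OF approximatesI])
    show "recursive ?\<Theta>"
      by (intro rec_intros \<Phi>[THEN approximates_recursive, THEN recursive_compose]
          \<Gamma>[THEN approximates_recursive, THEN recursive_compose])
  next
    fix p r n k v
    assume "Option.bind (G p) F = Some r" and "?\<Theta> (n, prefix p k) = Some v"
    then obtain q where q: "G p = Some q" "F q = Some r" by (auto simp: bind_eq_Some_conv)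
    from \<open>?\<Theta> (n, prefix p k) = Some v\<close> obtain l where "?try (n, prefix p k) l = Some v"
      unfolding bfind_Some by blast
    then have l: "(if \<exists>i<l. \<Gamma> (i, prefix p k) = None then None
        else \<Phi> (n, map (\<lambda>i. value_or_0 (\<Gamma> (i, prefix p k))) [0..<l])) = Some v"
      unfolding fst_conv snd_conv .
    from l have "\<Gamma> (i, prefix p k) = Some (q i)" if "i < l" for i
      using that approximates_sound[OF \<Gamma>, OF q(1), of i k] by (fastforce split: if_splits)
    then have q_eq: "map (\<lambda>i. value_or_0 (\<Gamma> (i, prefix p k))) [0..<l] = prefix q l" by simp
    from l have "\<Phi> (n, prefix q l) = Some v" unfolding q_eq by (auto split: if_splits)
    with approximates_sound[OF \<Phi>, OF q(2)] show "v = r n" by blast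
  next
    fix p r n
    assume "Option.bind (G p) F = Some r"
    then obtain q where q: "G p = Some q" "F q = Some r" by (auto simp: bind_eq_Some_conv)
    obtain l where l: "\<Phi> (n, prefix q l) \<noteq> None"
      using approximates_defined[OF \<Phi>, OF q(2), of n] unfolding eventually_sequentially by blast
    have "\<forall>\<^sub>F k in sequentially. \<forall>i\<in>{..<l}. \<Gamma> (i, prefix p k) = Some (q i)"
      by (rule eventually_ball_finite) (use approximates_eventually[OF \<Gamma>, OF q(1)] in auto)
    then show "\<forall>\<^sub>F k in sequentially. ?\<Theta> (n, prefix p k) \<noteq> None"
      using eventually_ge_at_top[of l]
    proof eventually_elim
      case (elim k)
      then have q_eq: "map (\<lambda>i. value_or_0 (\<Gamma> (i, prefix p k))) [0..<l] = prefix q l" by simp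
      have "\<not> (\<exists>i<l. \<Gamma> (i, prefix p k) = None)" using elim by auto
      then have "?try (n, prefix p k) l \<noteq> None"
        unfolding fst_conv snd_conv q_eq using l by (simp only: if_False not_False_eq_True)
      moreover have "l < Suc (length (snd (n, prefix p k)))" using elim by simp
      ultimately show ?case by (intro bfind_definedI)
    qed
  qed
qed

lemma computable_b_compose_total:
  assumes "computable_b F" "computable_b (\<lambda>p. Some (g p))"
  shows "computable_b (\<lambda>p. F (g p))"
  using computable_b_compose[OF assms] by simp

definition pair_fun :: "(baire \<Rightarrow> baire option) \<Rightarrow> (baire \<Rightarrow> baire option) \<Rightarrow> baire \<Rightarrow> baire option" where
  "pair_fun F G p = (case F p of None \<Rightarrow> None | Some a \<Rightarrow>
     (case G p of None \<Rightarrow> None | Some b \<Rightarrow> Some (pair_b a b)))"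

lemma computable_b_pair:
  assumes "computable_b F" "computable_b G"
  shows "computable_b (pair_fun F G)"
proof -
  obtain \<Phi> where \<Phi>: "approximates \<Phi> F" using computable_b_approximates assms(1) by blast
  obtain \<Gamma> where \<Gamma>: "approximates \<Gamma> G" using computable_b_approximates assms(2) by blast
  let ?\<Theta> = "\<lambda>y. if even (fst y) then \<Phi> (fst y div 2, snd y) else \<Gamma> (fst y div 2, snd y)"
  show ?thesis
  proof (rule approximates_computable_b[OF approximatesI])
    show "recursive ?\<Theta>"
      by (intro rec_intros \<Phi>[THEN approximates_recursive, THEN recursive_compose]
          \<Gamma>[THEN approximates_recursive, THEN recursive_compose])
  next
    fix p r n k v
    assume "pair_fun F G p = Some r" "?\<Theta> (n, prefix p k) = Some v"
    then show "v = r n"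
      by (auto simp: pair_fun_def pair_b_def split: option.splits if_splits
          dest: approximates_sound[OF \<Phi>] approximates_sound[OF \<Gamma>])
  next
    fix p r n
    assume "pair_fun F G p = Some r"
    then obtain a b where ab: "F p = Some a" "G p = Some b"
      by (auto simp: pair_fun_def split: option.splits)
    show "\<forall>\<^sub>F k in sequentially. ?\<Theta> (n, prefix p k) \<noteq> None"
      using approximates_defined[OF \<Phi>, OF ab(1), of "n div 2"] approximates_defined[OF \<Gamma>, OF ab(2), of "n div 2"]
      by eventually_elim simp
  qed
qed

lemma computable_b_pair_total:
  assumes "computable_b (\<lambda>p. Some (f p))" "computable_b (\<lambda>p. Some (g p))"
  shows "computable_b (\<lambda>p. Some (pair_b (f p) (g p)))"
  using computable_b_pair[OF assms] by (simp add: pair_fun_def[abs_def])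

section \<open>Kleene associates: evaluation and currying\<close>

lemma assoc_apply_eqI:
  assumes "\<And>n. \<exists>k. b (prod_encode (n, prefix_code x k)) = Suc (e n) \<and>
     (\<forall>i<k. b (prod_encode (n, prefix_code x i)) = 0)"
  shows "assoc_apply b x = Some e"
proof -
  have "(LEAST k. b (prod_encode (n, prefix_code x k)) \<noteq> 0) = k"
    if "b (prod_encode (n, prefix_code x k)) = Suc (e n)" "\<forall>i<k. b (prod_encode (n, prefix_code x i)) = 0" for n k
    using that by (intro Least_equality) (auto simp: not_less[symmetric])
  then have "b (prod_encode (n, prefix_code x (LEAST k. b (prod_encode (n, prefix_code x k)) \<noteq> 0))) = Suc (e n)" for n
    using assms[of n] by metis
  moreover have "\<exists>k. b (prod_encode (n, prefix_code x k)) \<noteq> 0" for n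
    using assms[of n] by (metis nat.distinct(1))
  ultimately show ?thesis unfolding assoc_apply_def by simp
qed

lemma assoc_apply_SomeD:
  assumes "assoc_apply b x = Some e"
  obtains k where "b (prod_encode (n, prefix_code x k)) = Suc (e n)"
    "\<And>i. i < k \<Longrightarrow> b (prod_encode (n, prefix_code x i)) = 0"
proof -
  let ?P = "\<lambda>k. b (prod_encode (n, prefix_code x k)) \<noteq> 0"
  from assms have ex: "\<exists>k. ?P k" and e: "e n = b (prod_encode (n, prefix_code x (LEAST k. ?P k))) - 1"
    by (auto simp: assoc_apply_def split: if_splits)
  from LeastI_ex[OF ex] e have "b (prod_encode (n, prefix_code x (LEAST k. ?P k))) = Suc (e n)" by simp
  moreover have "b (prod_encode (n, prefix_code x i)) = 0" if "i < (LEAST k. ?P k)" for i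
    using not_less_Least[OF that] by simp
  ultimately show thesis by (rule that)
qed

lemma computable_b_assoc_apply: "computable_b (\<lambda>u. assoc_apply (lft u) (rgt u))"
proof -
  let ?val = "\<lambda>y k. if length (snd y) < 2 * k then None
    else lookup (snd y) (2 * prod_encode (fst y, list_encode (map (\<lambda>i. value_or_0 (lookup (snd y) (Suc (2 * i)))) [0..<k])))"
  \<comment> \<open>Only the first nonzero entry counts, and the entries sit at code positions that
    may lie beyond the prefix read. An unreadable entry therefore aborts the search with
    \<open>Some None\<close>; skipping it could pick up a later entry with another value.\<close>
  let ?stop = "\<lambda>y k. case ?val y k of None \<Rightarrow> Some None
    | Some v \<Rightarrow> (case v of 0 \<Rightarrow> None | Suc w \<Rightarrow> Some (Some w))"
  let ?\<Theta> = "\<lambda>y. case bfind (?stop y) (Suc (length (snd y))) of None \<Rightarrow> None | Some r \<Rightarrow> r"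
  have val: "?val (n, prefix u m) k = (if m < 2 * k then None
      else lookup (prefix u m) (2 * prod_encode (n, prefix_code (rgt u) k)))" for n u m k
  proof (cases "m < 2 * k")
    case False
    then have eq: "map (\<lambda>i. value_or_0 (lookup (prefix u m) (Suc (2 * i)))) [0..<k] = prefix (rgt u) k"
      by (auto simp: lookup_prefix rgt_def)
    with False show ?thesis unfolding fst_conv snd_conv prefix_code_def eq by simp
  qed simp
  have val_Some: "v = lft u (prod_encode (n, prefix_code (rgt u) k))"
    if "?val (n, prefix u m) k = Some v" for n u m k v
    using that unfolding val by (auto simp: lookup_prefix lft_def split: if_splits)
  show ?thesis
  proof (rule approximates_computable_b[OF approximatesI])
    show "recursive ?\<Theta>" by (intro rec_intros)
  next
    fix u e n m v
    assume e: "assoc_apply (lft u) (rgt u) = Some e" and "?\<Theta> (n, prefix u m) = Some v"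
    then have "bfind (?stop (n, prefix u m)) (Suc (length (snd (n, prefix u m)))) = Some (Some v)"
      by (simp only: option.simps split: option.splits)
    then obtain k where k: "?stop (n, prefix u m) k = Some (Some v)" "\<And>i. i < k \<Longrightarrow> ?stop (n, prefix u m) i = None"
      unfolding bfind_Some by blast
    have "?val (n, prefix u m) k = Some (Suc v)"
      using k(1) by (simp only: split: option.splits nat.splits) auto
    then have 1: "lft u (prod_encode (n, prefix_code (rgt u) k)) = Suc v" using val_Some by metis
    have "?val (n, prefix u m) i = Some 0" if "i < k" for i
      using k(2)[OF that] by (simp only: split: option.splits nat.splits) auto
    then have 2: "lft u (prod_encode (n, prefix_code (rgt u) i)) = 0" if "i < k" for i
      using val_Some that by metis
    obtain k' where k': "lft u (prod_encode (n, prefix_code (rgt u) k')) = Suc (e n)"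
      "\<And>i. i < k' \<Longrightarrow> lft u (prod_encode (n, prefix_code (rgt u) i)) = 0"
      using assoc_apply_SomeD[OF e, of n] by blast
    have "k = k'" using 1 2 k' by (metis nat.distinct(1) nat_neq_iff)
    with 1 k' show "v = e n" by simp
  next
    fix u e n
    assume e: "assoc_apply (lft u) (rgt u) = Some e"
    obtain k where k: "lft u (prod_encode (n, prefix_code (rgt u) k)) = Suc (e n)"
      "\<And>i. i < k \<Longrightarrow> lft u (prod_encode (n, prefix_code (rgt u) i)) = 0"
      using assoc_apply_SomeD[OF e, of n] by blast
    have "\<forall>\<^sub>F m in sequentially. \<forall>i\<in>{..k}. 2 * prod_encode (n, prefix_code (rgt u) i) < m"
      by (rule eventually_ball_finite) (auto intro: eventually_gt_at_top)
    then show "\<forall>\<^sub>F m in sequentially. ?\<Theta> (n, prefix u m) \<noteq> None"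
      using eventually_ge_at_top[of "2 * k"]
    proof eventually_elim
      case (elim m)
      have v: "?val (n, prefix u m) i = Some (lft u (prod_encode (n, prefix_code (rgt u) i)))" if "i \<le> k" for i
        unfolding val using elim that by (auto simp: lookup_prefix lft_def)
      have "?stop (n, prefix u m) k = Some (Some (e n))"
        unfolding v[OF order_refl] k(1) by simp
      moreover have "?stop (n, prefix u m) i = None" if "i < k" for i
        unfolding v[OF less_imp_le[OF that]] k(2)[OF that] by simp
      moreover have "k < Suc (length (snd (n, prefix u m)))" using elim(2) by simp
      ultimately have "bfind (?stop (n, prefix u m)) (Suc (length (snd (n, prefix u m)))) = Some (Some (e n))"
        unfolding bfind_Some by blast
      then show ?case by (simp only: option.case) simp
    qed
  qed
qed

lemma lft_pair [simp]: "lft (pair_b p q) = p" and rgt_pair [simp]: "rgt (pair_b p q) = q"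
  by (auto simp: lft_def rgt_def pair_b_def)

lemma prefix_pair:
  "map (\<lambda>j. if even j then value_or_0 (lookup (prefix p m) (j div 2)) else value_or_0 (lookup (prefix x k) (j div 2))) [0..<2 * k]
    = prefix (pair_b p x) (2 * k)" if "k \<le> m"
  using that by (auto simp: lookup_prefix pair_b_def)

text \<open>The smn theorem for associates. At the code of \<open>(n, xs)\<close> the sequence
  \<open>K p\<close> interleaves \<open>xs\<close> with equally many entries of \<open>p\<close> and
  runs \<open>\<Phi>\<close> on the result; 0 records that there is no answer yet,
  \<open>Suc v\<close> the answer \<open>v\<close>. Each entry is one evaluation of a total
  function, so \<open>K p\<close> exists for every \<open>p\<close>.\<close>

lemma computable_b_curry:
  assumes "computable_b F"
  obtains K where "computable_b (\<lambda>p. Some (K p))"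
    "\<And>p x e. F (pair_b p x) = Some e \<Longrightarrow> assoc_apply (K p) x = Some e"
proof -
  obtain \<Phi> where \<Phi>: "approximates \<Phi> F" using computable_b_approximates assms(1) by blast
  let ?xs = "\<lambda>i. list_decode (snd (prod_decode i))"
  let ?v = "\<lambda>i ps. case \<Phi> (fst (prod_decode i), map (\<lambda>j. if even j then value_or_0 (lookup ps (j div 2))
      else value_or_0 (lookup (?xs i) (j div 2))) [0..<2 * length (?xs i)]) of None \<Rightarrow> 0 | Some v \<Rightarrow> Suc v"
  let ?K = "\<lambda>p i. ?v i (prefix p (length (?xs i)))"
  let ?\<Theta> = "\<lambda>y. if length (snd y) < length (?xs (fst y)) then None
     else Some (?v (fst y) (take (length (?xs (fst y))) (snd y)))"
  have "computable_b (\<lambda>p. Some (?K p))"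
  proof (rule approximates_computable_b[OF approximatesI])
    show "recursive ?\<Theta>"
      by (intro rec_intros \<Phi>[THEN approximates_recursive, THEN recursive_compose])
  next
    fix p q :: baire and n k v
    assume q: "Some (?K p) = Some q" and v: "?\<Theta> (n, prefix p k) = Some v"
    from v have le: "length (?xs n) \<le> k" by (rule contrapos_pp) simp
    with v have "v = ?v n (take (length (?xs n)) (prefix p k))"
      unfolding fst_conv snd_conv by (subst (asm) if_not_P) simp_all
    then have "v = ?K p n" unfolding take_prefix[OF le] .
    with q show "v = q n" by blast
  next
    fix p q :: baire and n
    show "\<forall>\<^sub>F k in sequentially. ?\<Theta> (n, prefix p k) \<noteq> None"
      using eventually_ge_at_top[of "length (?xs n)"] by eventually_elim simp
  qed
  moreover have "assoc_apply (?K p) x = Some e" if F: "F (pair_b p x) = Some e" for p x e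
  proof -
    define t where "t = ?K p"
    have K: "t (prod_encode (n, prefix_code x k)) =
        (case \<Phi> (n, prefix (pair_b p x) (2 * k)) of None \<Rightarrow> 0 | Some v \<Rightarrow> Suc v)" for n k
    proof -
      have xs: "list_decode (prefix_code x k) = prefix x k" by (simp add: prefix_code_def)
      have len: "length (prefix x k) = k" by simp
      show ?thesis
        unfolding t_def prod_encode_inverse fst_conv snd_conv xs len prefix_pair[OF order_refl] ..
    qed
    have "\<exists>k. t (prod_encode (n, prefix_code x k)) = Suc (e n) \<and>
        (\<forall>i<k. t (prod_encode (n, prefix_code x i)) = 0)" for n
    proof -
      from approximates_defined[OF \<Phi>, OF F, of n]
      obtain N where N: "\<forall>k\<ge>N. \<Phi> (n, prefix (pair_b p x) k) \<noteq> None"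
        unfolding eventually_sequentially by (rule exE)
      \<comment> \<open>The associate tests only prefixes of even length \<open>2 * k\<close>. That
        one of these is answered comes from definedness on all long prefixes.\<close>
      define k where "k = (LEAST k. \<Phi> (n, prefix (pair_b p x) (2 * k)) \<noteq> None)"
      have "\<Phi> (n, prefix (pair_b p x) (2 * k)) \<noteq> None"
        unfolding k_def
      proof (rule LeastI[of "\<lambda>k. \<Phi> (n, prefix (pair_b p x) (2 * k)) \<noteq> None" N])
        show "\<Phi> (n, prefix (pair_b p x) (2 * N)) \<noteq> None" by (rule N[rule_format]) simp
      qed
      then obtain v where v: "\<Phi> (n, prefix (pair_b p x) (2 * k)) = Some v" by blast
      with approximates_sound[OF \<Phi>, OF F] have "v = e n" by blast
      with v have "t (prod_encode (n, prefix_code x k)) = Suc (e n)" unfolding K by simp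
      moreover have "t (prod_encode (n, prefix_code x i)) = 0" if "i < k" for i
      proof -
        have "\<Phi> (n, prefix (pair_b p x) (2 * i)) = None" using not_less_Least[OF that[unfolded k_def]] by simp
        then show ?thesis unfolding K by simp
      qed
      ultimately show ?thesis by blast
    qed
    then show ?thesis unfolding t_def by (rule assoc_apply_eqI)
  qed
  ultimately show thesis by (rule that)
qed

text \<open>The zero sequence means \<open>not confirmed\<close>. Where \<^term>\<open>F\<close> confirms, the machine for \<^term>\<open>G\<close>
  may be undefined or give wrong answers.\<close>
lemma computable_b_parallel_or:
  assumes "computable_b F" "computable_b G"
  obtains E where "computable_b (\<lambda>u. Some (E u))"
    "\<And>u a. F u = Some a \<Longrightarrow> a \<noteq> (\<lambda>_. 0) \<Longrightarrow> E u \<noteq> (\<lambda>_. 0)"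
    "\<And>u b. F u = Some (\<lambda>_. 0) \<Longrightarrow> G u = Some b \<Longrightarrow> E u = (\<lambda>_. 0) \<longleftrightarrow> b = (\<lambda>_. 0)"
proof -
  obtain \<Phi> where \<Phi>: "approximates \<Phi> F" using computable_b_approximates assms(1) by blast
  obtain \<Gamma> where \<Gamma>: "approximates \<Gamma> G" using computable_b_approximates assms(2) by blast
  let ?T = "\<lambda>xs n. \<exists>m<n. 0 < value_or_0 (\<Phi> (m, xs)) \<or> 0 < value_or_0 (\<Gamma> (m, xs))"
  \<comment> \<open>Entry \<open>n\<close> records whether one of the machines has shown a nonzero
    output at a position below \<open>n\<close> after reading \<open>n\<close> entries. It depends
    on finitely many entries of \<open>u\<close> and is defined whatever the machines do, so
    \<open>E u\<close> is always a name in Sierpinski space.\<close>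
  define E where "E u n = (if ?T (prefix u n) n then 1 else 0 :: nat)" for u n
  let ?\<Theta> = "\<lambda>y. if length (snd y) < fst y then None
     else Some (if ?T (take (fst y) (snd y)) (fst y) then 1 else 0)"
  have comp: "computable_b (\<lambda>u. Some (E u))"
  proof (rule approximates_computable_b[OF approximatesI])
    show "recursive ?\<Theta>"
      by (intro rec_intros \<Phi>[THEN approximates_recursive, THEN recursive_compose]
          \<Gamma>[THEN approximates_recursive, THEN recursive_compose])
  next
    fix p q :: baire and n k and v :: nat
    assume "Some (E p) = Some q" "?\<Theta> (n, prefix p k) = Some v"
    then show "v = q n"
      using take_prefix[of n k p] by (auto simp: E_def split: if_splits)
  next
    fix p q :: baire and n
    show "\<forall>\<^sub>F k in sequentially. ?\<Theta> (n, prefix p k) \<noteq> None"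
      using eventually_ge_at_top[of n] by eventually_elim simp
  qed
  have confirm: "E u \<noteq> (\<lambda>_. 0)"
    if Z: "(Z = \<Phi> \<and> A = F) \<or> (Z = \<Gamma> \<and> A = G)" and A: "A u = Some a" "a \<noteq> (\<lambda>_. 0)" for u a Z A
  proof -
    obtain m where m: "a m \<noteq> 0" using A(2) by auto
    have "approximates Z A" using Z \<Phi> \<Gamma> by blast
    from approximates_eventually[OF this, OF A(1), of m] eventually_gt_at_top[of m]
    have "\<forall>\<^sub>F k in sequentially. E u k = 1"
    proof eventually_elim
      case (elim k)
      then have "?T (prefix u k) k" using Z m by (intro exI[of _ m]) auto
      then show ?case unfolding E_def by (rule if_P)
    qed
    then obtain k where "E u k = 1" unfolding eventually_sequentially by blast
    then show ?thesis by auto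
  qed
  have neither: "E u = (\<lambda>_. 0) \<longleftrightarrow> b = (\<lambda>_. 0)" if F: "F u = Some (\<lambda>_. 0)" and G: "G u = Some b" for u b
  proof
    assume E0: "E u = (\<lambda>_. 0)"
    show "b = (\<lambda>_. 0)"
    proof (rule ccontr)
      assume "b \<noteq> (\<lambda>_. 0)"
      from confirm[OF disjI2[OF conjI[OF refl refl]], OF G this] E0 show False by (rule notE)
    qed
  next
    assume b: "b = (\<lambda>_. 0)"
    have "value_or_0 (\<Phi> (m, prefix u n)) = 0" "value_or_0 (\<Gamma> (m, prefix u n)) = 0" for m n
      using approximates_zero[OF \<Phi>, OF F, of m n] approximates_zero[OF \<Gamma>, OF G[unfolded b], of m n] .
    then show "E u = (\<lambda>_. 0)" by (simp add: E_def fun_eq_iff)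
  qed
  show thesis
    by (rule that[OF comp confirm[OF disjI1[OF conjI[OF refl refl]]] neither])
qed

section \<open>Weihrauch reductions to choice problems\<close>

text \<open>Turns the quantification over realizers into a statement about single names. A realizer
  \<open>G0\<close> obtained by choice may be changed at one name \<open>k0\<close>: to any name of
  a solution, or to \<open>None\<close> if \<open>k0\<close> names no instance. The result is again
  a realizer, and the reduction has to cope with it. The condition on \<open>ran\<close> gives every
  solution a name, so that \<open>G0\<close> is a realizer.\<close>

lemma W_leD:
  assumes le: "W_le dX dY f dU dV g" and ran: "\<And>u. g u \<subseteq> ran dV"
  obtains H K where "computable_b H" "computable_b K"
    "\<And>p x. dX p = Some x \<Longrightarrow> f x \<noteq> {} \<Longrightarrow> \<exists>k u. K p = Some k \<and> dU k = Some u \<and> g u \<noteq> {} \<and>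
      (\<forall>r v. dV r = Some v \<longrightarrow> v \<in> g u \<longrightarrow> (\<exists>q y. H (pair_b p r) = Some q \<and> dY q = Some y \<and> y \<in> f x))"
proof -
  from le obtain H K where HK: "computable_b H" "computable_b K"
    and red: "\<And>G. realizer dU dV g G \<Longrightarrow> realizer dX dY f (\<lambda>p. case K p of None \<Rightarrow> None
       | Some k \<Rightarrow> (case G k of None \<Rightarrow> None | Some r \<Rightarrow> H (pair_b p r)))"
    unfolding W_le_def by blast
  define good where "good k r \<longleftrightarrow> (\<exists>u v. dU k = Some u \<and> dV r = Some v \<and> v \<in> g u)" for k r
  define G0 where "G0 k = (if \<exists>r. good k r then Some (SOME r. good k r) else None)" for k
  have ex: "\<exists>r. good k r" if "dU k = Some u" "g u \<noteq> {}" for k u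
  proof -
    obtain v where v: "v \<in> g u" using \<open>g u \<noteq> {}\<close> by blast
    with ran[of u] obtain r where "dV r = Some v" by (auto simp: ran_def)
    with that v show ?thesis unfolding good_def by blast
  qed
  have G0: "\<exists>r. G0 k = Some r \<and> good k r" if "dU k = Some u" "g u \<noteq> {}" for k u
  proof -
    from ex[OF that] have "G0 k = Some (SOME r. good k r)" by (simp add: G0_def)
    with someI_ex[OF ex[OF that]] show ?thesis by blast
  qed
  have real: "realizer dU dV g (G0(k0 := z))" if z: "\<And>u. dU k0 = Some u \<Longrightarrow> g u \<noteq> {} \<Longrightarrow> \<exists>r. z = Some r \<and> good k0 r" for k0 z
    unfolding realizer_def
  proof (intro allI impI)
    fix k u assume u: "dU k = Some u" "g u \<noteq> {}"
    obtain r where r: "(G0(k0 := z)) k = Some r" "good k r"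
    proof (cases "k = k0")
      case True
      with u z that show thesis by auto
    next
      case False
      with G0[OF u] that show thesis by auto
    qed
    from r(2) u(1) obtain v where "dV r = Some v" "v \<in> g u" unfolding good_def by auto
    with r(1) show "\<exists>q y. (G0(k0 := z)) k = Some q \<and> dV q = Some y \<and> y \<in> g u" by blast
  qed
  have "\<exists>k u. K p = Some k \<and> dU k = Some u \<and> g u \<noteq> {} \<and>
      (\<forall>r v. dV r = Some v \<longrightarrow> v \<in> g u \<longrightarrow> (\<exists>q y. H (pair_b p r) = Some q \<and> dY q = Some y \<and> y \<in> f x))"
    if x: "dX p = Some x" "f x \<noteq> {}" for p x
  proof -
    have use: "\<exists>q y. (case K p of None \<Rightarrow> None | Some k \<Rightarrow>
        (case G k of None \<Rightarrow> None | Some r \<Rightarrow> H (pair_b p r))) = Some q \<and> dY q = Some y \<and> y \<in> f x"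
      if "realizer dU dV g G" for G
      by (rule red[OF that, unfolded realizer_def, rule_format, OF x])
    have "realizer dU dV g (G0(p := G0 p))" by (rule real) (rule G0)
    from use[OF this] obtain k where k: "K p = Some k" by (auto split: option.splits)
    have "\<exists>u. dU k = Some u \<and> g u \<noteq> {}"
    proof (rule ccontr)
      assume "\<not> ?thesis"
      \<comment> \<open>If \<open>k\<close> named no instance, a realizer could be undefined there,
        and the composite would have no output at \<open>p\<close>.\<close>
      then have "realizer dU dV g (G0(k := None))" by (intro real) auto
      from use[OF this] k show False by simp
    qed
    then obtain u where u: "dU k = Some u" "g u \<noteq> {}" by blast
    have "\<exists>q y. H (pair_b p r) = Some q \<and> dY q = Some y \<and> y \<in> f x"
      if "dV r = Some v" "v \<in> g u" for r v
    proof -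
      have "good k r" using that u unfolding good_def by blast
      then have "realizer dU dV g (G0(k := Some r))" by (intro real) auto
      from use[OF this] k show ?thesis by simp
    qed
    with k u show ?thesis by blast
  qed
  with HK show thesis by (rule that)
qed

lemma W_leI:
  assumes "computable_b H" "computable_b K"
    and "\<And>p x. dX p = Some x \<Longrightarrow> f x \<noteq> {} \<Longrightarrow> \<exists>k u. K p = Some k \<and> dU k = Some u \<and> g u \<noteq> {} \<and>
      (\<forall>r v. dV r = Some v \<longrightarrow> v \<in> g u \<longrightarrow> (\<exists>q y. H (pair_b p r) = Some q \<and> dY q = Some y \<and> y \<in> f x))"
  shows "W_le dX dY f dU dV g"
  unfolding W_le_def
proof (rule exI[of _ H], rule exI[of _ K], intro conjI assms(1,2) allI impI)
  fix G assume G: "realizer dU dV g G"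
  show "realizer dX dY f (\<lambda>p. case K p of None \<Rightarrow> None
       | Some k \<Rightarrow> (case G k of None \<Rightarrow> None | Some r \<Rightarrow> H (pair_b p r)))"
    unfolding realizer_def
  proof (intro allI impI)
    fix p x assume "dX p = Some x" "f x \<noteq> {}"
    from assms(3)[OF this] obtain k u where k: "K p = Some k" "dU k = Some u" "g u \<noteq> {}"
      and ans: "\<And>r v. dV r = Some v \<Longrightarrow> v \<in> g u \<Longrightarrow> \<exists>q y. H (pair_b p r) = Some q \<and> dY q = Some y \<and> y \<in> f x"
      by blast
    from G k obtain r v where "G k = Some r" "dV r = Some v" "v \<in> g u"
      unfolding realizer_def by blast
    with ans[of r v] k show "\<exists>q y. (case K p of None \<Rightarrow> None
       | Some k \<Rightarrow> (case G k of None \<Rightarrow> None | Some r \<Rightarrow> H (pair_b p r))) = Some q \<and> dY q = Some y \<and> y \<in> f x"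
      by simp
  qed
qed

lemma ran_id_rep [simp]: "ran (id_rep R) = R"
  by (auto simp: ran_def id_rep_def)

lemma prod_rep_id_rep: "prod_rep (id_rep R) (id_rep S) x = Some z \<longleftrightarrow> lft x \<in> R \<and> rgt x \<in> S \<and> z = (lft x, rgt x)"
  by (auto simp: prod_rep_def id_rep_def)

lemma ran_prod_rep_id_rep [simp]: "ran (prod_rep (id_rep R) (id_rep S)) = R \<times> S"
proof -
  have "(r, s) \<in> ran (prod_rep (id_rep R) (id_rep S))" if "r \<in> R" "s \<in> S" for r s
    using that by (auto simp: ran_def prod_rep_id_rep intro!: exI[of _ "pair_b r s"])
  then show ?thesis by (auto simp: ran_def prod_rep_id_rep)
qed

text \<open>Whether a point belongs to the set can be read off from the value of the associate on
  any name of the point. This gives the \<open>THE\<close> in \<open>closed_neg\<close> its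
  meaning.\<close>

lemma neg_name_cond_unique:
  assumes "neg_name_cond dX t A" "neg_name_cond dX t B" shows "A = B"
proof -
  have sub: "C \<subseteq> ran dX" if "neg_name_cond dX t C" for C
    using that closedin_subset unfolding neg_name_cond_def by fastforce
  have mem: "x \<in> C \<longleftrightarrow> assoc_apply t q = Some (\<lambda>_. 0)"
    if "neg_name_cond dX t C" "dX q = Some x" for C q x
  proof -
    have "x \<in> ran dX" using that(2) by (auto simp: ran_def)
    from that obtain r where "assoc_apply t q = Some r"
      "sier_rep r = Some (if x \<in> ran dX - C then 1 else 0)"
      unfolding neg_name_cond_def sier_fun_name_def by blast
    with \<open>x \<in> ran dX\<close> show ?thesis by (auto simp: sier_rep_def split: if_splits)
  qed
  have "x \<in> A \<longleftrightarrow> x \<in> B" if "x \<in> ran dX" for x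
  proof -
    from that obtain q where "dX q = Some x" by (auto simp: ran_def)
    with mem assms show ?thesis by blast
  qed
  with sub assms show ?thesis by blast
qed

lemma closed_neg_eq_Some: "closed_neg dX t = Some A \<longleftrightarrow> neg_name_cond dX t A"
proof
  assume "closed_neg dX t = Some A"
  then have "\<exists>B. neg_name_cond dX t B" "A = (THE B. neg_name_cond dX t B)"
    by (auto simp: closed_neg_def split: if_splits)
  then show "neg_name_cond dX t A"
    using neg_name_cond_unique by (metis theI)
next
  assume A: "neg_name_cond dX t A"
  then have "(THE B. neg_name_cond dX t B) = A"
    using neg_name_cond_unique by (intro the_equality)
  with A show "closed_neg dX t = Some A" by (auto simp: closed_neg_def)
qed

lemma closed_neg_id_repD:
  assumes "closed_neg (id_rep S) t = Some A" "q \<in> S"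
  obtains e where "assoc_apply t q = Some e" "e = (\<lambda>_. 0) \<longleftrightarrow> q \<in> A"
proof -
  have "id_rep S q = Some q" using assms(2) by (simp add: id_rep_def)
  moreover have "sier_fun_name (id_rep S) t (\<lambda>x. if x \<in> S - A then 1 else 0)"
    using assms(1) unfolding closed_neg_eq_Some neg_name_cond_def ran_id_rep by blast
  ultimately obtain r where "assoc_apply t q = Some r" "sier_rep r = Some (if q \<in> S - A then 1 else 0)"
    unfolding sier_fun_name_def by blast
  with assms(2) that show thesis by (auto simp: sier_rep_def split: if_splits)
qed

lemma open_prefix_cylinder: "open {f :: baire. \<forall>i<k. f i = g i}"
proof -
  have "{f :: baire. \<forall>i<k. f i = g i} = (\<Inter>i\<in>{..<k}. (\<lambda>f. f i) -` {g i})" by auto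
  moreover have "open ((\<lambda>f :: baire. f i) -` {g i})" for i
    by (intro open_vimage open_discrete continuous_on_product_coordinates)
  ultimately show ?thesis by (auto intro!: open_INT)
qed

text \<open>A nonzero output at \<open>x\<close> is produced after reading finitely many entries of
  \<open>x\<close>, hence also at every point of a cylinder around it; such a cylinder misses
  \<open>C\<close>, where the output is zero.\<close>

lemma closedin_of_semidecidable:
  assumes C: "C \<subseteq> R \<times> S"
    and t: "\<And>x. lft x \<in> R \<Longrightarrow> rgt x \<in> S \<Longrightarrow> \<exists>e. assoc_apply t x = Some e \<and> (e = (\<lambda>_. 0) \<longleftrightarrow> (lft x, rgt x) \<in> C)"
  shows "closedin (top_of_set (R \<times> S)) C"
proof -
  have "openin (top_of_set (R \<times> S)) (R \<times> S - C)"
  proof (subst openin_subopen, intro ballI)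
    fix z assume z: "z \<in> R \<times> S - C"
    obtain r s where rs: "z = (r, s)" "r \<in> R" "s \<in> S" "(r, s) \<notin> C" using z by auto
    obtain e where e: "assoc_apply t (pair_b r s) = Some e" "e \<noteq> (\<lambda>_. 0)"
      using t[of "pair_b r s"] rs by auto
    then obtain n where n: "e n \<noteq> 0" by auto
    obtain k where k: "t (prod_encode (n, prefix_code (pair_b r s) k)) = Suc (e n)"
      "\<And>i. i < k \<Longrightarrow> t (prod_encode (n, prefix_code (pair_b r s) i)) = 0"
      using assoc_apply_SomeD[OF e(1), of n] by blast
    let ?U = "{f. \<forall>i<k. f i = r i} \<times> {f. \<forall>i<k. f i = s i}"
    have "(r', s') \<notin> C" if "r' \<in> R" "s' \<in> S" "(r', s') \<in> ?U" for r' s'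
    proof
      assume "(r', s') \<in> C"
      with t[of "pair_b r' s'"] that have e': "assoc_apply t (pair_b r' s') = Some (\<lambda>_. 0)" by auto
      obtain k' where k': "t (prod_encode (n, prefix_code (pair_b r' s') k')) = Suc 0"
        "\<And>i. i < k' \<Longrightarrow> t (prod_encode (n, prefix_code (pair_b r' s') i)) = 0"
        using assoc_apply_SomeD[OF e', of n] by blast
      \<comment> \<open>A prefix of length \<open>k\<close> of a pair involves at most
        \<open>k\<close> entries of either component, so agreement of both up to \<open>k\<close> is
        enough.\<close>
      have same: "prefix_code (pair_b r' s') i = prefix_code (pair_b r s) i" if "i \<le> k" for i
        using that \<open>(r', s') \<in> ?U\<close> by (auto simp: prefix_code_def pair_b_def list_encode_eq)
      have "k' = k"
      proof (rule ccontr)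
        assume "k' \<noteq> k"
        then consider "k' < k" | "k < k'" by linarith
        then show False using k k' same by cases (metis less_imp_le nat.distinct(1) order_refl)+
      qed
      with k k' same n show False by simp
    qed
    then have "R \<times> S \<inter> ?U \<subseteq> R \<times> S - C" by auto
    moreover have "openin (top_of_set (R \<times> S)) (R \<times> S \<inter> ?U)"
      by (intro openin_open_Int open_Times open_prefix_cylinder)
    moreover have "z \<in> R \<times> S \<inter> ?U" using rs by auto
    ultimately show "\<exists>T. openin (top_of_set (R \<times> S)) T \<and> z \<in> T \<and> T \<subseteq> R \<times> S - C" by blast
  qed
  with C show ?thesis by (simp add: closedin_def)
qed

lemma closed_neg_prodI:
  assumes C: "C \<subseteq> R \<times> S"
    and t: "\<And>x. lft x \<in> R \<Longrightarrow> rgt x \<in> S \<Longrightarrow> \<exists>e. assoc_apply t x = Some e \<and> (e = (\<lambda>_. 0) \<longleftrightarrow> (lft x, rgt x) \<in> C)"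
  shows "closed_neg (prod_rep (id_rep R) (id_rep S)) t = Some C"
  unfolding closed_neg_eq_Some neg_name_cond_def sier_fun_name_def ran_prod_rep_id_rep
proof (intro conjI allI impI)
  show "closedin (top_of_set (R \<times> S)) C" by (rule closedin_of_semidecidable[OF C t])
  fix x z assume "prod_rep (id_rep R) (id_rep S) x = Some z"
  then have z: "lft x \<in> R" "rgt x \<in> S" "z = (lft x, rgt x)" by (auto simp: prod_rep_id_rep)
  with t[of x] show "\<exists>r. assoc_apply t x = Some r \<and> sier_rep r = Some (if z \<in> R \<times> S - C then 1 else 0)"
    by (auto simp: sier_rep_def)
qed

section \<open>Measures\<close>

text \<open>Serves the open endpoints, where a strict pointwise bound has to survive
  integration.\<close>

lemma set_nn_integral_strict_mono:
  assumes "f \<in> borel_measurable M" "g \<in> borel_measurable M" "A \<in> sets M" "emeasure M A \<noteq> 0"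
    and less: "\<And>x. x \<in> A \<Longrightarrow> f x < g x" and fin: "(\<integral>\<^sup>+x\<in>A. f x \<partial>M) \<noteq> \<infinity>"
  shows "(\<integral>\<^sup>+x\<in>A. f x \<partial>M) < (\<integral>\<^sup>+x\<in>A. g x \<partial>M)"
proof (rule nn_integral_less)
  show "\<not> (AE x in M. g x * indicator A x \<le> f x * indicator A x)"
  proof
    assume "AE x in M. g x * indicator A x \<le> f x * indicator A x"
    then have "AE x in M. x \<notin> A"
      by eventually_elim (use less in \<open>auto simp: indicator_def not_le[symmetric] split: if_splits\<close>)
    then show False using assms(3,4) by (simp add: AE_iff_measurable[OF _ refl] sets.sets_into_space Int_absorb2 Collect_conj_eq)
  qed
qed (use assms in \<open>auto simp: indicator_def intro: less_imp_le\<close>)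

lemma set_nn_integral_cmult_bound:
  assumes "A \<in> sets M" "\<And>x. x \<in> A \<Longrightarrow> c \<le> f x"
  shows "c * emeasure M A \<le> (\<integral>\<^sup>+x\<in>A. f x \<partial>M)"
proof -
  have "c * emeasure M A = (\<integral>\<^sup>+x\<in>A. c \<partial>M)" using assms by (simp add: nn_integral_cmult_indicator)
  also have "\<dots> \<le> (\<integral>\<^sup>+x\<in>A. f x \<partial>M)"
    by (rule nn_integral_mono) (use assms in \<open>auto simp: indicator_def\<close>)
  finally show ?thesis .
qed

lemma set_nn_integral_cmult_bound_upper:
  assumes "A \<in> sets M" "\<And>x. x \<in> A \<Longrightarrow> f x \<le> c"
  shows "(\<integral>\<^sup>+x\<in>A. f x \<partial>M) \<le> c * emeasure M A"
proof -
  have "(\<integral>\<^sup>+x\<in>A. f x \<partial>M) \<le> (\<integral>\<^sup>+x\<in>A. c \<partial>M)"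
    by (rule nn_integral_mono) (use assms in \<open>auto simp: indicator_def\<close>)
  also have "\<dots> = c * emeasure M A" using assms by (simp add: nn_integral_cmult_indicator)
  finally show ?thesis .
qed

text \<open>If \<^term>\<open>A\<close> has finite positive measure, the mean value of \<^term>\<open>h\<close> on \<^term>\<open>A\<close> lies in \<^term>\<open>I\<close>;
  if the measure is infinite and the integral \<^term>\<open>v\<close> is positive and finite, then \<^term>\<open>I\<close> contains
  arbitrarily small and \<^term>\<open>J\<close> arbitrarily large positive reals, and \<^term>\<open>v\<close> splits accordingly.\<close>
lemma set_nn_integral_in_interval_product:
  fixes h :: "'a \<Rightarrow> ennreal"
  assumes I_def: "I = ext_interval lcI aI bI rcI" and J_def: "J = ext_interval lcJ aJ bJ rcJ"
    and top: "bI = \<infinity> \<longrightarrow> rcI"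
    and A: "A \<in> sets M" "A \<noteq> {}" "enn2ereal (emeasure M A) \<in> J"
    and h: "h \<in> borel_measurable M" "\<And>x. x \<in> A \<Longrightarrow> enn2ereal (h x) \<in> I"
  shows "enn2ereal (\<integral>\<^sup>+x\<in>A. h x \<partial>M) \<in> set_prod_ereal I J"
proof -
  let ?m = "emeasure M A" and ?v = "\<integral>\<^sup>+x\<in>A. h x \<partial>M"
  have prodI: "z \<in> set_prod_ereal I J" if "x \<in> I" "y \<in> J" "z = x * y" for x y z
    using that unfolding set_prod_ereal_def by blast
  consider (null) "?m = 0" | (inf) "?m = \<infinity>" | (fin) "?m \<noteq> 0" "?m \<noteq> \<infinity>" by blast
  then show ?thesis
  proof cases
    case null
    \<comment> \<open>The trivial bound \<open>\<infinity>\<close> suffices, because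
      \<open>\<infinity> * 0 = 0\<close>.\<close>
    then have v: "?v = 0" using set_nn_integral_cmult_bound_upper[OF A(1), of h \<infinity>] by simp
    from A(2) obtain x where "x \<in> A" by blast
    from prodI[OF h(2)[OF this] A(3), of 0] show ?thesis by (simp add: v null zero_ennreal.rep_eq)
  next
    case inf
    then have J: "bJ = \<infinity>" "\<infinity> \<in> J" using A(3) unfolding J_def ext_interval_def
      by (auto split: if_splits)
    consider "?v = 0" | "?v = \<infinity>" | V where "0 < V" "?v = ennreal V"
      by (cases ?v) (auto simp: order.order_iff_strict top_ennreal.rep_eq)
    then show ?thesis
    proof cases
      case 1
      have "\<exists>x\<in>A. h x = 0"
      proof (rule ccontr)
        assume "\<not> ?thesis"
        then have "(\<integral>\<^sup>+x\<in>A. 0 \<partial>M) < ?v"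
          using inf by (intro set_nn_integral_strict_mono A h) (auto simp: zero_less_iff_neq_zero)
        with 1 show False by simp
      qed
      then obtain x where x: "x \<in> A" "h x = 0" by blast
      from prodI[OF h(2)[OF x(1)] J(2), of 0] show ?thesis by (simp add: 1 x zero_ennreal.rep_eq)
    next
      case 2
      have "\<exists>x\<in>A. h x \<noteq> 0"
      proof (rule ccontr)
        assume "\<not> ?thesis"
        then have "?v \<le> 0 * ?m" by (intro set_nn_integral_cmult_bound_upper A) auto
        with 2 show False by simp
      qed
      then obtain x where x: "x \<in> A" "0 < h x" by (auto simp: zero_less_iff_neq_zero)
      from x(2) have "0 < enn2ereal (h x)" by (simp add: less_ennreal.rep_eq zero_ennreal.rep_eq)
      then have "\<infinity> = enn2ereal (h x) * \<infinity>" by (cases "enn2ereal (h x)") auto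
      from prodI[OF h(2)[OF x(1)] J(2) this] show ?thesis by (simp add: 2)
    next
      case (3 V)
      have "\<exists>x\<in>A. h x \<noteq> 0"
      proof (rule ccontr)
        assume "\<not> ?thesis"
        then have "?v \<le> 0 * ?m" by (intro set_nn_integral_cmult_bound_upper A) auto
        with 3 show False by simp
      qed
      then obtain x where x: "x \<in> A" "0 < h x" by (auto simp: zero_less_iff_neq_zero)
      \<comment> \<open>A finite stand-in for \<open>h x\<close>, which may be infinite while
        \<open>V / c\<close> has to be a real.\<close>
      obtain c where c: "0 < c" "ereal c \<le> enn2ereal (h x)"
      proof (cases "h x")
        case (real r)
        with x that[of r] show thesis by (auto simp: ennreal_zero_less_top)
      next
        case top
        with that[of 1] show thesis by (auto simp: top_ennreal.rep_eq)
      qed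
      \<comment> \<open>A positive lower bound on a set of infinite measure would make the integral
        infinite.\<close>
      have a: "aI \<le> 0"
      proof (rule ccontr)
        assume "\<not> aI \<le> 0"
        then have "0 < aI" by simp
        have "ennreal aI * ?m \<le> ?v"
        proof (rule set_nn_integral_cmult_bound[OF A(1)])
          fix x assume "x \<in> A"
          from h(2)[OF this] have "ereal aI \<le> enn2ereal (h x)"
            unfolding I_def ext_interval_def by (auto split: if_splits)
          with \<open>0 < aI\<close> show "ennreal aI \<le> h x"
            by (simp add: less_eq_ennreal.rep_eq)
        qed
        with inf 3 \<open>0 < aI\<close> show False by (simp add: ennreal_mult_top top_unique)
      qed
      \<comment> \<open>The first bound puts \<open>y\<close> above 0 and above the left endpoint of
        \<open>J\<close>; the second gives \<open>V / y \<le> c\<close>, so \<open>V / y\<close>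
        lies between 0 and the value \<open>h x\<close> of \<open>I\<close>.\<close>
      define y where "y = max (\<bar>aJ\<bar> + 1) (V / c)"
      then have "\<bar>aJ\<bar> + 1 \<le> y" "V / c \<le> y" by auto
      then have y: "0 < y" "aJ < y" "V / y \<le> c"
        using c(1) by (linarith, linarith, simp add: field_simps)
      have "ereal (V / y) \<in> I"
      proof -
        have "0 < V / y" using y 3 by simp
        then have "ereal aI < ereal (V / y)" using a by simp
        moreover have "ereal (V / y) \<le> enn2ereal (h x)"
          using y(3) c(2) by (meson ereal_less_eq(3) order_trans)
        ultimately show ?thesis
          using h(2)[OF x(1)] unfolding I_def ext_interval_def by (auto split: if_splits intro: le_less_trans)
      qed
      moreover have "ereal y \<in> J"
        using y(2) J unfolding J_def ext_interval_def by (auto split: if_splits)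
      ultimately show ?thesis
        by (rule prodI) (use y 3 in simp)
    qed
  next
    case fin
    obtain m where m: "?m = ennreal m" "0 < m"
      using fin by (cases ?m) (auto simp: order.order_iff_strict)
    have lower: "ereal aI \<le> enn2ereal (h x)" "\<not> lcI \<Longrightarrow> ereal aI < enn2ereal (h x)"
      "enn2ereal (h x) \<le> bI" "\<not> rcI \<Longrightarrow> enn2ereal (h x) < bI" if "x \<in> A" for x
      using h(2)[OF that] unfolding I_def ext_interval_def by (auto split: if_splits)
    have bI: "0 \<le> bI" using A(2) lower(3) by (meson enn2ereal_nonneg equals0I order_trans)
    show ?thesis
    proof (cases "?v")
      case top
      \<comment> \<open>A finite right endpoint \<open>b\<close> would bound the integral by
        \<open>b\<close> times a finite measure. As \<open>h\<close> may still be finite everywhere,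
        \<open>\<infinity>\<close> in \<open>I\<close> cannot be taken from a value of
        \<open>h\<close>; it comes from the hypothesis on the endpoint.\<close>
      have "bI = \<infinity>"
      proof (rule ccontr)
        assume "bI \<noteq> \<infinity>"
        with bI obtain b where b: "bI = ereal b" "0 \<le> b" by (cases bI) auto
        have "?v \<le> ennreal b * ?m"
          by (rule set_nn_integral_cmult_bound_upper[OF A(1)])
            (use lower(3) b in \<open>simp add: less_eq_ennreal.rep_eq\<close>)
        with top m show False by (simp add: ennreal_mult[symmetric] b(2) less_imp_le top_unique)
      qed
      with \<open>bI = \<infinity> \<longrightarrow> rcI\<close> have "\<infinity> \<in> I" unfolding I_def ext_interval_def by simp
      from prodI[OF this A(3), of \<infinity>] m top show ?thesis by (simp add: top_ennreal.rep_eq)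
    next
      case (real V)
      have "ereal (V / m) \<in> I"
      proof -
        have lo: "ereal aI \<le> ereal (V / m) \<and> (\<not> lcI \<longrightarrow> ereal aI < ereal (V / m))"
        proof (cases "aI < 0")
          \<comment> \<open>\<open>ennreal\<close> sends negative reals to 0, so a negative left
            endpoint cannot enter the integral bounds; there nonnegativity of the mean is
            enough.\<close>
          case True
          have "0 \<le> V / m" using m real by simp
          with True show ?thesis by simp
        next
          case False
          have "ennreal aI * ?m \<le> ?v"
            by (rule set_nn_integral_cmult_bound[OF A(1)])
              (use lower(1) False in \<open>simp add: less_eq_ennreal.rep_eq\<close>)
          with m real False have "aI * m \<le> V" by (simp add: ennreal_mult[symmetric])
          moreover have "aI * m < V" if "\<not> lcI"
          proof -
            have "(\<integral>\<^sup>+x\<in>A. ennreal aI \<partial>M) < ?v"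
              by (rule set_nn_integral_strict_mono)
                (use A h fin lower(2)[OF _ that] False m in \<open>auto simp: nn_integral_cmult_indicator less_ennreal.rep_eq ennreal_mult[symmetric]\<close>)
            with A m real False show ?thesis
              by (simp add: nn_integral_cmult_indicator ennreal_mult[symmetric] ennreal_less_iff)
          qed
          ultimately show ?thesis using m by (auto simp: field_simps)
        qed
        have hi: "ereal (V / m) \<le> bI \<and> (\<not> rcI \<longrightarrow> ereal (V / m) < bI)"
        proof (cases "bI = \<infinity>")
          case True
          with top show ?thesis by simp
        next
          case False
          with bI obtain b where b: "bI = ereal b" "0 \<le> b" by (cases bI) auto
          have "?v \<le> ennreal b * ?m"
            by (rule set_nn_integral_cmult_bound_upper[OF A(1)])
              (use lower(3) b in \<open>simp add: less_eq_ennreal.rep_eq\<close>)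
          with m real b have "V \<le> b * m" by (simp add: ennreal_mult[symmetric])
          moreover have "V < b * m" if "\<not> rcI"
          proof -
            have "?v < (\<integral>\<^sup>+x\<in>A. ennreal b \<partial>M)"
              by (rule set_nn_integral_strict_mono)
                (use A h fin lower(4)[OF _ that] b real in \<open>auto simp: less_ennreal.rep_eq\<close>)
            with A m real b show ?thesis
              by (simp add: nn_integral_cmult_indicator ennreal_mult[symmetric] ennreal_less_iff)
          qed
          ultimately show ?thesis using m b by (auto simp: field_simps)
        qed
        from lo hi show ?thesis unfolding I_def ext_interval_def by auto
      qed
      then show ?thesis
        by (rule prodI[OF _ A(3)]) (use m real in simp)
    qed
  qed
qed

text \<open>\<open>R\<close> and \<open>S\<close> are arbitrary subsets, so \<open>C\<close> is
  treated as the preimage of a closed \<open>D\<close> under the inclusion of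
  \<open>R \<times> S\<close>, which is measurable in each component. Second countability puts
  \<open>D\<close> into the product of the Borel sigma-algebras.\<close>

lemma closedin_Times_sets_pair_measure:
  fixes MR :: "'a::second_countable_topology measure" and MS :: "'b::second_countable_topology measure"
  assumes "sets MR = sets (restrict_space borel R)" "sets MS = sets (restrict_space borel S)"
    and "closedin (top_of_set (R \<times> S)) C"
  shows "C \<in> sets (MR \<Otimes>\<^sub>M MS)"
proof -
  from assms(3) obtain D where D: "closed D" "C = R \<times> S \<inter> D" by (auto simp: closedin_closed)
  have id: "(\<lambda>x. x) \<in> measurable N borel" if "sets N = sets (restrict_space borel X)" for N and X :: "'c::topological_space set"
    using measurable_restrict_space1[OF measurable_ident, of borel X, unfolded id_def]
    by (simp add: measurable_cong_sets[OF that refl])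
  have sp: "space MR = R" "space MS = S"
    using sets_eq_imp_space_eq[OF assms(1)] sets_eq_imp_space_eq[OF assms(2)] by (auto simp: space_restrict_space)
  have "(\<lambda>z. (fst z, snd z)) \<in> measurable (MR \<Otimes>\<^sub>M MS) (borel \<Otimes>\<^sub>M borel)"
    using measurable_compose[OF measurable_fst id[OF assms(1)]] measurable_compose[OF measurable_snd id[OF assms(2)]]
    by (intro measurable_Pair) auto
  moreover have "D \<in> sets (borel \<Otimes>\<^sub>M borel)" unfolding borel_prod using D(1) by (rule borel_closed)
  ultimately have "(\<lambda>z. (fst z, snd z)) -` D \<inter> space (MR \<Otimes>\<^sub>M MS) \<in> sets (MR \<Otimes>\<^sub>M MS)"
    by (rule measurable_sets)
  also have "(\<lambda>z. (fst z, snd z)) -` D \<inter> space (MR \<Otimes>\<^sub>M MS) = C"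
    using D(2) by (auto simp: space_pair_measure sp)
  finally show ?thesis .
qed

lemma closedin_sets_restrict_space:
  assumes "sets M = sets (restrict_space borel R)" "closedin (top_of_set R) B"
  shows "B \<in> sets M"
proof -
  from assms(2) obtain D where "closed D" "B = R \<inter> D" by (auto simp: closedin_closed)
  then show ?thesis unfolding assms(1) sets_restrict_space by auto
qed

section \<open>The product reduction\<close>

theorem theorem4p3:
  fixes R S :: "baire set" and MR MS :: "baire measure"
    and lcI rcI lcJ rcJ :: bool and aI aJ :: real and bI bJ :: ereal
    and dW :: "'w rep" and dZ :: "'z rep" and dY :: "'y rep"
    and f0 :: "'z \<Rightarrow> 'y set" and g0 :: "'w \<Rightarrow> 'z set"
  assumes "sets MR = sets (restrict_space borel R)" "sigma_finite_measure MR"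
    and "sets MS = sets (restrict_space borel S)" "sigma_finite_measure MS"
    and "bI \<noteq> -\<infinity>" "bJ \<noteq> -\<infinity>"
    and "bI = \<infinity> \<longrightarrow> rcI"
    and "problem dZ dY f0" "problem dW dZ g0"
    and "W_le dZ dY f0 (closed_neg (id_rep R)) (id_rep R) (PC (ext_interval lcI aI bI rcI) MR)"
    and "W_le dW dZ g0 (closed_neg (id_rep S)) (id_rep S) (PC (ext_interval lcJ aJ bJ rcJ) MS)"
  shows "W_le dW dY (mcomp f0 g0)
           (closed_neg (prod_rep (id_rep R) (id_rep S))) (prod_rep (id_rep R) (id_rep S))
           (PC (set_prod_ereal (ext_interval lcI aI bI rcI) (ext_interval lcJ aJ bJ rcJ)) (MR \<Otimes>\<^sub>M MS))"
proof -
  let ?I = "ext_interval lcI aI bI rcI" and ?J = "ext_interval lcJ aJ bJ rcJ"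
  interpret pair_sigma_finite MR MS
    using assms(2,4) by (simp add: pair_sigma_finite_def)
  have sp: "space MR = R" "space MS = S"
    using sets_eq_imp_space_eq[OF assms(1)] sets_eq_imp_space_eq[OF assms(3)] by (auto simp: space_restrict_space)
  have PC_ran: "PC L MR B \<subseteq> ran (id_rep R)" "PC L MS B \<subseteq> ran (id_rep S)" for L B
    by (auto simp: PC_def sp dest!: closedin_subset split: if_splits)
  obtain H1 K1 where c1: "computable_b H1" "computable_b K1"
    and f: "\<And>p z. dZ p = Some z \<Longrightarrow> f0 z \<noteq> {} \<Longrightarrow> \<exists>k B. K1 p = Some k \<and>
      closed_neg (id_rep R) k = Some B \<and> PC ?I MR B \<noteq> {} \<and> (\<forall>r v. id_rep R r = Some v \<longrightarrow>
      v \<in> PC ?I MR B \<longrightarrow> (\<exists>s y. H1 (pair_b p r) = Some s \<and> dY s = Some y \<and> y \<in> f0 z))"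
    using W_leD[OF assms(10) PC_ran(1)] by blast
  obtain H2 K2 where c2: "computable_b H2" "computable_b K2"
    and g: "\<And>p w. dW p = Some w \<Longrightarrow> g0 w \<noteq> {} \<Longrightarrow> \<exists>k A. K2 p = Some k \<and>
      closed_neg (id_rep S) k = Some A \<and> PC ?J MS A \<noteq> {} \<and> (\<forall>q v. id_rep S q = Some v \<longrightarrow>
      v \<in> PC ?J MS A \<longrightarrow> (\<exists>s z. H2 (pair_b p q) = Some s \<and> dZ s = Some z \<and> z \<in> g0 w))"
    using W_leD[OF assms(11) PC_ran(2)] by blast

  \<comment> \<open>Throughout \<open>u\<close> stands for the pairing of \<open>p\<close> with a
    point \<open>x\<close>, itself the pairing of \<open>r\<close> and \<open>q\<close>; hence
    \<open>lft (rgt u)\<close> is \<open>r\<close> and \<open>rgt (rgt u)\<close> is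
    \<open>q\<close>. \<open>Z u\<close> names the intermediate value that \<open>q\<close> leads
    to, \<open>E1\<close> tests \<open>q\<close> against \<open>A\<close>, and \<open>E2\<close>
    tests \<open>r\<close> against \<open>B q\<close>.\<close>
  define Z where "Z u = H2 (pair_b (lft u) (rgt (rgt u)))" for u
  define E1 where "E1 u = Option.bind (pair_fun (\<lambda>u. K2 (lft u)) (\<lambda>u. Some (rgt (rgt u))) u)
    (\<lambda>v. assoc_apply (lft v) (rgt v))" for u
  define E2 where "E2 u = Option.bind (pair_fun (\<lambda>u. Option.bind (Z u) K1) (\<lambda>u. Some (lft (rgt u))) u)
    (\<lambda>v. assoc_apply (lft v) (rgt v))" for u
  define H where "H u = Option.bind (pair_fun Z (\<lambda>u. Some (lft (rgt u))) u) H1" for u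
  have parts: "computable_b (\<lambda>u. Some (rgt (rgt u)))" "computable_b (\<lambda>u. Some (lft (rgt u)))"
    using computable_b_compose_total[OF computable_b_rgt computable_b_rgt]
      computable_b_compose_total[OF computable_b_lft computable_b_rgt] .
  have cZ: "computable_b Z"
    unfolding Z_def[abs_def]
    by (rule computable_b_compose_total[OF c2(1) computable_b_pair_total[OF computable_b_lft parts(1)]])
  have cE1: "computable_b E1"
    unfolding E1_def[abs_def]
    by (rule computable_b_compose[OF computable_b_assoc_apply computable_b_pair[OF
          computable_b_compose_total[OF c2(2) computable_b_lft] parts(1)]])
  have cE2: "computable_b E2"
    unfolding E2_def[abs_def]
    by (rule computable_b_compose[OF computable_b_assoc_apply computable_b_pair[OF
          computable_b_compose[OF c1(2) cZ] parts(2)]])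
  have cH: "computable_b H"
    unfolding H_def[abs_def]
    by (rule computable_b_compose[OF c1(1) computable_b_pair[OF cZ parts(2)]])
  obtain E where cE: "computable_b (\<lambda>u. Some (E u))"
    and E_out: "\<And>u a. E1 u = Some a \<Longrightarrow> a \<noteq> (\<lambda>_. 0) \<Longrightarrow> E u \<noteq> (\<lambda>_. 0)"
    and E_in: "\<And>u b. E1 u = Some (\<lambda>_. 0) \<Longrightarrow> E2 u = Some b \<Longrightarrow> E u = (\<lambda>_. 0) \<longleftrightarrow> b = (\<lambda>_. 0)"
    using computable_b_parallel_or[OF cE1 cE2] by blast
  obtain K where cK: "computable_b (\<lambda>p. Some (K p))"
    and "\<And>p x e. Some (E (pair_b p x)) = Some e \<Longrightarrow> assoc_apply (K p) x = Some e"
    using computable_b_curry[OF cE] by blast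
  then have K: "assoc_apply (K p) x = Some (E (pair_b p x))" for p x by blast

  show ?thesis
  proof (rule W_leI[OF cH cK])
    fix p w assume w: "dW p = Some w" "mcomp f0 g0 w \<noteq> {}"
    then have g0: "g0 w \<noteq> {}" and f0: "\<And>z. z \<in> g0 w \<Longrightarrow> f0 z \<noteq> {}"
      and mcomp: "mcomp f0 g0 w = \<Union> (f0 ` g0 w)"
      by (auto simp: mcomp_def split: if_splits)
    from g[OF w(1) g0] obtain k2 A where k2: "K2 p = Some k2" "closed_neg (id_rep S) k2 = Some A"
      and PCA: "PC ?J MS A \<noteq> {}"
      and ans: "\<And>q v. id_rep S q = Some v \<Longrightarrow> v \<in> PC ?J MS A \<Longrightarrow>
        \<exists>s z. H2 (pair_b p q) = Some s \<and> dZ s = Some z \<and> z \<in> g0 w"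
      by blast
    then have H2: "\<exists>s z. H2 (pair_b p q) = Some s \<and> dZ s = Some z \<and> z \<in> g0 w"
      if "q \<in> S" "q \<in> PC ?J MS A" for q
      using ans[of q q] that by (simp add: id_rep_def)
    from PCA have A: "A \<noteq> {}" "closedin (top_of_set S) A" "enn2ereal (emeasure MS A) \<in> ?J" "PC ?J MS A = A"
      by (auto simp: PC_def sp split: if_splits)
    have AS: "A \<subseteq> S" using A(2) closedin_subset by fastforce
    define P where "P q s k1 B \<longleftrightarrow> H2 (pair_b p q) = Some s \<and> K1 s = Some k1 \<and>
        closed_neg (id_rep R) k1 = Some B \<and> PC ?I MR B \<noteq> {} \<and>
        (\<forall>r\<in>B \<inter> R. \<exists>s' y. H1 (pair_b s r) = Some s' \<and> dY s' = Some y \<and> y \<in> mcomp f0 g0 w)" for q s k1 B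
    have "\<exists>s k1 B. P q s k1 B" if q: "q \<in> A" for q
    proof -
      from H2[of q] q AS A(4) obtain s z where s: "H2 (pair_b p q) = Some s" "dZ s = Some z" "z \<in> g0 w" by blast
      \<comment> \<open>\<open>mcomp\<close> is nonempty only if \<open>f0\<close> is defined at
        every value in \<open>g0 w\<close>, so whichever \<open>z\<close> the point \<open>q\<close>
        leads to is a legal input.\<close>
      from f[OF s(2) f0[OF s(3)]] obtain k1 B where B: "K1 s = Some k1" "closed_neg (id_rep R) k1 = Some B"
        "PC ?I MR B \<noteq> {}" and H1: "\<And>r v. id_rep R r = Some v \<Longrightarrow> v \<in> PC ?I MR B \<Longrightarrow>
          \<exists>s' y. H1 (pair_b s r) = Some s' \<and> dY s' = Some y \<and> y \<in> f0 z"
        by blast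
      have "PC ?I MR B = B" using B(3) by (auto simp: PC_def split: if_splits)
      then have "\<exists>s' y. H1 (pair_b s r) = Some s' \<and> dY s' = Some y \<and> y \<in> mcomp f0 g0 w" if "r \<in> B \<inter> R" for r
        using H1[of r r] that s(3) unfolding mcomp by (auto simp: id_rep_def)
      with s(1) B show ?thesis unfolding P_def by blast
    qed
    \<comment> \<open>The choice is only notational: \<open>H2\<close>, \<open>K1\<close> and
      \<open>closed_neg\<close> are functions, so \<open>q\<close> determines \<open>s\<close>,
      \<open>k1\<close> and \<open>B\<close>. The set tested by \<open>E2\<close> is thus the same
      \<open>B q\<close> that defines \<open>C\<close>.\<close>
    then obtain s k1 B where "\<And>q. q \<in> A \<Longrightarrow> P q (s q) (k1 q) (B q)" by metis
    then have H2: "\<And>q. q \<in> A \<Longrightarrow> H2 (pair_b p q) = Some (s q)"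
      and K1: "\<And>q. q \<in> A \<Longrightarrow> K1 (s q) = Some (k1 q)"
      and k1: "\<And>q. q \<in> A \<Longrightarrow> closed_neg (id_rep R) (k1 q) = Some (B q)"
      and PCB: "\<And>q. q \<in> A \<Longrightarrow> PC ?I MR (B q) \<noteq> {}"
      and H1: "\<And>q r. q \<in> A \<Longrightarrow> r \<in> B q \<inter> R \<Longrightarrow>
        \<exists>s' y. H1 (pair_b (s q) r) = Some s' \<and> dY s' = Some y \<and> y \<in> mcomp f0 g0 w"
      unfolding P_def by blast+
    have B: "B q \<noteq> {}" "closedin (top_of_set R) (B q)" "enn2ereal (emeasure MR (B q)) \<in> ?I" if "q \<in> A" for q
      using PCB[OF that] by (auto simp: PC_def sp split: if_splits)
    have BR: "B q \<subseteq> R" if "q \<in> A" for q using B(2)[OF that] closedin_subset by fastforce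

    define C where "C = {(r, q). q \<in> A \<and> r \<in> B q}"
    have CRS: "C \<subseteq> R \<times> S" using AS BR by (auto simp: C_def)
    have name: "\<exists>e. assoc_apply (K p) x = Some e \<and> (e = (\<lambda>_. 0) \<longleftrightarrow> (lft x, rgt x) \<in> C)"
      if x: "lft x \<in> R" "rgt x \<in> S" for x
    proof -
      obtain e1 where e1: "assoc_apply k2 (rgt x) = Some e1" "e1 = (\<lambda>_. 0) \<longleftrightarrow> rgt x \<in> A"
        using closed_neg_id_repD[OF k2(2) x(2)] by blast
      then have E1: "E1 (pair_b p x) = Some e1" by (simp add: E1_def pair_fun_def k2)
      have "E (pair_b p x) = (\<lambda>_. 0) \<longleftrightarrow> (lft x, rgt x) \<in> C"
      proof (cases "rgt x \<in> A")
        case True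
        obtain e2 where e2: "assoc_apply (k1 (rgt x)) (lft x) = Some e2" "e2 = (\<lambda>_. 0) \<longleftrightarrow> lft x \<in> B (rgt x)"
          using closed_neg_id_repD[OF k1[OF True] x(1)] by blast
        then have "E2 (pair_b p x) = Some e2"
          by (simp add: E2_def pair_fun_def Z_def H2[OF True] K1[OF True])
        moreover have "E1 (pair_b p x) = Some (\<lambda>_. 0)" using E1 e1(2) True by simp
        ultimately have "E (pair_b p x) = (\<lambda>_. 0) \<longleftrightarrow> e2 = (\<lambda>_. 0)" by (intro E_in)
        with e2(2) True show ?thesis by (simp add: C_def)
      next
        case False
        with e1(2) E_out[OF E1] show ?thesis by (simp add: C_def)
      qed
      with K show ?thesis by blast
    qed
    have closed: "closedin (top_of_set (R \<times> S)) C" by (rule closedin_of_semidecidable[OF CRS name])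
    have Csets: "C \<in> sets (MR \<Otimes>\<^sub>M MS)"
      by (rule closedin_Times_sets_pair_measure[OF assms(1,3) closed])
    \<comment> \<open>Taken as the measure of the section of \<open>C\<close>, because
      \<open>B\<close> is arbitrary outside \<open>A\<close>, whereas the sections are empty there
      and depend measurably on \<open>q\<close>.\<close>
    define h where "h q = emeasure MR ((\<lambda>r. (r, q)) -` C)" for q
    have h_A: "h q = emeasure MR (B q)" if "q \<in> A" for q
      using that by (auto simp: h_def C_def intro!: arg_cong[where f = "emeasure MR"])
    have h_out: "h q = 0" if "q \<notin> A" for q
      using that by (simp add: h_def C_def vimage_def)
    have "emeasure (MR \<Otimes>\<^sub>M MS) C = (\<integral>\<^sup>+q. h q \<partial>MS)"
      unfolding h_def by (rule emeasure_pair_measure_alt2[OF Csets])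
    also have "\<dots> = (\<integral>\<^sup>+q\<in>A. h q \<partial>MS)"
      by (rule nn_integral_cong) (auto simp: indicator_def h_out)
    finally have "enn2ereal (emeasure (MR \<Otimes>\<^sub>M MS) C) = enn2ereal (\<integral>\<^sup>+q\<in>A. h q \<partial>MS)" by simp
    also have "\<dots> \<in> set_prod_ereal ?I ?J"
    proof (rule set_nn_integral_in_interval_product[OF refl refl assms(7)])
      show "A \<in> sets MS" by (rule closedin_sets_restrict_space[OF assms(3) A(2)])
      show "h \<in> borel_measurable MS"
        unfolding h_def[abs_def] by (rule measurable_emeasure_Pair2[OF Csets])
    qed (use A B h_A in auto)
    finally have meas: "enn2ereal (emeasure (MR \<Otimes>\<^sub>M MS) C) \<in> set_prod_ereal ?I ?J" .
    have "C \<noteq> {}" using A(1) B(1) by (auto simp: C_def)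
    with meas closed have PCC: "PC (set_prod_ereal ?I ?J) (MR \<Otimes>\<^sub>M MS) C = C"
      by (simp add: PC_def space_pair_measure sp)
    show "\<exists>k u. Some (K p) = Some k \<and>
        closed_neg (prod_rep (id_rep R) (id_rep S)) k = Some u \<and>
        PC (set_prod_ereal ?I ?J) (MR \<Otimes>\<^sub>M MS) u \<noteq> {} \<and>
        (\<forall>x v. prod_rep (id_rep R) (id_rep S) x = Some v \<longrightarrow>
          v \<in> PC (set_prod_ereal ?I ?J) (MR \<Otimes>\<^sub>M MS) u \<longrightarrow>
          (\<exists>q y. H (pair_b p x) = Some q \<and> dY q = Some y \<and> y \<in> mcomp f0 g0 w))"
    proof (rule exI[of _ "K p"], rule exI[of _ C], intro conjI allI impI)
      show "closed_neg (prod_rep (id_rep R) (id_rep S)) (K p) = Some C"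
        by (rule closed_neg_prodI[OF CRS name])
      show "PC (set_prod_ereal ?I ?J) (MR \<Otimes>\<^sub>M MS) C \<noteq> {}" using PCC \<open>C \<noteq> {}\<close> by simp
    next
      fix x v assume "prod_rep (id_rep R) (id_rep S) x = Some v" "v \<in> PC (set_prod_ereal ?I ?J) (MR \<Otimes>\<^sub>M MS) C"
      then have x: "rgt x \<in> A" "lft x \<in> B (rgt x) \<inter> R"
        unfolding PCC by (auto simp: prod_rep_id_rep C_def)
      have "H (pair_b p x) = H1 (pair_b (s (rgt x)) (lft x))"
        by (simp add: H_def pair_fun_def Z_def H2[OF x(1)])
      with H1[OF x] show "\<exists>q y. H (pair_b p x) = Some q \<and> dY q = Some y \<and> y \<in> mcomp f0 g0 w" by simp
    qed simp
  qed
qed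

end
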